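(* For every integer $m\ge 15$, $$z_{\mathrm{RL}}(m,4)=z_2(m,4)=\left\lfloor \frac{5m+6}{2}\right\rfloor .$$ Moreover, for every $m\ge 15$, every extremal configuration for $z_{\mathrm{RL}}(m,4)$ (that is, every configuration $G$ feasible in the definition of $z_{\mathrm{RL}}(m,4)$ with $N(G)=z_{\mathrm{RL}}(m,4)$) has exactly $H=0$ holes when $m$ is even and exactly $H=1$ hole when $m$ is odd.
   Context: For a positive integer $r$ put $[r]=\{1,\dots,r\}$. Elements of the grid $[m]\times[n]$ are called cells; $(i,j)$ is in row $i$ and column $j$. A genuine rectangle is given by rows $i\ne k$ and columns $j\ne \ell$; it has the two diagonals $\{(i,j),(k,\ell)\}$ and $\{(i,\ell),(k,j)\}$. The classical Zarankiewicz number $z(m,n)$ is the maximum size of a set of cells of $[m]\times[n]$ containing no genuine rectangle with all four corners in the set (such a set, viewed as a bipartite graph, is called $C_4$-free). An augmented configuration $G=([m],[n],E_1\cup E_2)$ consists of a set $E_1$ of cells (one-edges) and a set $E_2$ of two-edges, a two-edge being an unordered pair of distinct cells (the two cells may share a row or a column). The support of a one-edge $(i,j)$ is $\{(i,j)\}$; the support of a two-edge $\{p,q\}$ is $\{p,q\}$. $G$ satisfies condition (S), i.e. is simple, if distinct selected edges (elements of $E_1\cup E_2$) have disjoint supports. Let $\Omega=E_1\cup\bigcup_{e\in E_2}e$ be the set of occupied cells; the other cells are holes; $H=mn-|\Omega|$ is the number of holes; $N(G)=|E_1|+|E_2|$. For distinct cells $p,q$ put $\delta(p,q)=1$ if $\{p,q\}\in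 E_2$ and $\delta(p,q)=0$ otherwise. The strengthened closure of $G$ consists of the least equivalence relation $\sim$ on $\Omega$ and the least symmetric relation $\perp_R$ on $\Omega$ jointly closed under the following rules (only consequences of finitely many rule applications are certified): - Line rule: for distinct occupied cells $p,q$ in the same row or the same column, if $\delta(p,q)=0$ add $p\perp_R q$; if $\delta(p,q)=1$ add $p\sim q$. - Saturation rule: if $p\sim p'$, $q\sim q'$ and $p'\perp_R q'$, add $p\perp_R q$. - Rectangle transfer: let a genuine rectangle have diagonals $\{p,q\}$ (target) and $\{r,s\}$ (companion). Suppose the companion is certified to have its prescribed value: if $\delta(r,s)=0$, this means at least one of $r,s$ is a hole or $r\perp_R s$; if $\delta(r,s)=1$, it means $r,s$ are both occupied and $r\sim s$. Then, if $p,q$ are occupied and $\delta(p,q)=0$, add $p\perp_R q$; if $\delta(p,q)=1$, add $p\sim q$. - Complementary-pair rule: if both diagonals $\{p,q\}$, $\{r,s\}$ of a genuine rectangle are in $E_2$, add $p\sim q$ and $r\sim s$. A simple configuration satisfies $(\mathrm{RW3}^{+})$ if in its strengthened closure: every two-edge $\{p,q\}\in E_2$ has $p\sim q$; distinct selected edges determine distinct $\sim$-classes; and for any two distinct selected edges $e,f$ there are $p\in\operatorname{supp}(e)$, $q\in\operatorname{supp}(f)$ with $p\perp_R q$. The recursive-line Zarankiewicz number $z_{\mathrm{RL}}(m,n)$ is the maximum of $N(G)$ over all augmented configurations $G$ on $[m]\times[n]$ such that $|E_1|=z(m,n)$, $G$ satisfies (S), $E_1$ is $C_4$-free, and $G$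 satisfies $(\mathrm{RW3}^{+})$. The second-order number $z_2(m,n)$ is the maximum of $N(G)$ over all augmented configurations $G$ on $[m]\times[n]$ such that $|E_1|=z(m,n)$, $G$ satisfies (S), $E_1$ is $C_4$-free, and the biquadratic form $$P_G(x,y)=\sum_{(i,j)\in E_1}(x_iy_j)^2+\sum_{\{(i,j),(k,\ell)\}\in E_2}(x_iy_j+x_ky_\ell)^2$$ is irreducible in the sense that its SOS rank (the minimum number of squares of real bilinear forms in $x\in\mathbb R^m$, $y\in\mathbb R^n$ whose sum is $P_G$) equals $N(G)$. *)

theory Defs
  imports Complex_Main
begin

type_synonym cell = "nat \<times> nat"

definition grid :: "nat \<Rightarrow> nat \<Rightarrow> cell set" where
  "grid m n = {1..m} \<times> {1..n}"

definition C4_free :: "cell set \<Rightarrow> bool" where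
  "C4_free S \<longleftrightarrow>
     \<not> (\<exists>i k j l. i \<noteq> k \<and> j \<noteq> l \<and> (i, j) \<in> S \<and> (k, l) \<in> S \<and> (i, l) \<in> S \<and> (k, j) \<in> S)"

definition zarankiewicz :: "nat \<Rightarrow> nat \<Rightarrow> nat" where
  "zarankiewicz m n = Max {card S | S. S \<subseteq> grid m n \<and> C4_free S}"

record config =
  ones :: "cell set"
  twos :: "cell set set"

definition configuration :: "nat \<Rightarrow> nat \<Rightarrow> config \<Rightarrow> bool" where
  "configuration m n G \<longleftrightarrow>
     ones G \<subseteq> grid m n \<and>
     twos G \<subseteq> {{p, q} | p q. p \<in> grid m n \<and> q \<in> grid m n \<and> p \<noteq> q}"

text \<open>Selected edges are identified with their supports. No information is lost: a one-edge has a
  support of size one and a two-edge has a support of size two.\<close>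

definition edges :: "config \<Rightarrow> cell set set" where
  "edges G = (\<lambda>c. {c}) ` ones G \<union> twos G"

definition num_edges :: "config \<Rightarrow> nat" where
  "num_edges G = card (ones G) + card (twos G)"

definition simple :: "config \<Rightarrow> bool" where
  "simple G \<longleftrightarrow> (\<forall>e \<in> edges G. \<forall>f \<in> edges G. e \<noteq> f \<longrightarrow> e \<inter> f = {})"

definition occupied :: "config \<Rightarrow> cell set" where
  "occupied G = ones G \<union> \<Union> (twos G)"

definition num_holes :: "nat \<Rightarrow> nat \<Rightarrow> config \<Rightarrow> nat" where
  "num_holes m n G = card (grid m n - occupied G)"

text \<open>The strengthened closure. A genuine rectangle is given by rows \<open>i \<noteq> k\<close> and columns \<open>j \<noteq> l\<close>, with
  target diagonal \<open>(i, j), (k, l)\<close> and companion diagonal \<open>(i, l), (k, j)\<close>; exchanging \<open>j\<close> and \<open>l\<close>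
  exchanges the diagonals. The grid need not be mentioned: since the target cells are occupied, the
  companion cells lie in the grid, so one that is not occupied is a hole.\<close>

inductive sim :: "config \<Rightarrow> cell \<Rightarrow> cell \<Rightarrow> bool"
  and perp :: "config \<Rightarrow> cell \<Rightarrow> cell \<Rightarrow> bool"
  for G :: config
where
  sim_refl: "p \<in> occupied G \<Longrightarrow> sim G p p"
| sim_sym: "sim G p q \<Longrightarrow> sim G q p"
| sim_trans: "sim G p q \<Longrightarrow> sim G q r \<Longrightarrow> sim G p r"
| perp_sym: "perp G p q \<Longrightarrow> perp G q p"
| line_perp:
    "p \<in> occupied G \<Longrightarrow> q \<in> occupied G \<Longrightarrow> p \<noteq> q \<Longrightarrow> fst p = fst q \<or> snd p = snd q \<Longrightarrow>
     {p, q} \<notin> twos G \<Longrightarrow> perp G p q"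
| line_sim:
    "p \<in> occupied G \<Longrightarrow> q \<in> occupied G \<Longrightarrow> p \<noteq> q \<Longrightarrow> fst p = fst q \<or> snd p = snd q \<Longrightarrow>
     {p, q} \<in> twos G \<Longrightarrow> sim G p q"
| saturation: "sim G p p' \<Longrightarrow> sim G q q' \<Longrightarrow> perp G p' q' \<Longrightarrow> perp G p q"
| transfer_perp:
    "i \<noteq> k \<Longrightarrow> j \<noteq> l \<Longrightarrow> p = (i, j) \<Longrightarrow> q = (k, l) \<Longrightarrow> r = (i, l) \<Longrightarrow> s = (k, j) \<Longrightarrow>
     ({r, s} \<notin> twos G \<and> (r \<notin> occupied G \<or> s \<notin> occupied G \<or> perp G r s)) \<or>
     ({r, s} \<in> twos G \<and> sim G r s) \<Longrightarrow>
     p \<in> occupied G \<Longrightarrow> q \<in> occupied G \<Longrightarrow> {p, q} \<notin> twos G \<Longrightarrow> perp G p q"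
| transfer_sim:
    "i \<noteq> k \<Longrightarrow> j \<noteq> l \<Longrightarrow> p = (i, j) \<Longrightarrow> q = (k, l) \<Longrightarrow> r = (i, l) \<Longrightarrow> s = (k, j) \<Longrightarrow>
     ({r, s} \<notin> twos G \<and> (r \<notin> occupied G \<or> s \<notin> occupied G \<or> perp G r s)) \<or>
     ({r, s} \<in> twos G \<and> sim G r s) \<Longrightarrow>
     {p, q} \<in> twos G \<Longrightarrow> sim G p q"
| complementary:
    "i \<noteq> k \<Longrightarrow> j \<noteq> l \<Longrightarrow> {(i, j), (k, l)} \<in> twos G \<Longrightarrow> {(i, l), (k, j)} \<in> twos G \<Longrightarrow>
     sim G (i, j) (k, l)"

definition sim_class :: "config \<Rightarrow> cell \<Rightarrow> cell set" where
  "sim_class G p = {q. sim G p q}"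

definition RW3_plus :: "config \<Rightarrow> bool" where
  "RW3_plus G \<longleftrightarrow>
     (\<forall>p q. {p, q} \<in> twos G \<longrightarrow> sim G p q) \<and>
     (\<forall>e \<in> edges G. \<forall>f \<in> edges G. e \<noteq> f \<longrightarrow>
        (\<forall>p \<in> e. \<forall>q \<in> f. sim_class G p \<noteq> sim_class G q)) \<and>
     (\<forall>e \<in> edges G. \<forall>f \<in> edges G. e \<noteq> f \<longrightarrow> (\<exists>p \<in> e. \<exists>q \<in> f. perp G p q))"

definition admissible :: "nat \<Rightarrow> nat \<Rightarrow> config \<Rightarrow> bool" where
  "admissible m n G \<longleftrightarrow>
     configuration m n G \<and> card (ones G) = zarankiewicz m n \<and> simple G \<and> C4_free (ones G)"

definition RL_feasible :: "nat \<Rightarrow> nat \<Rightarrow> config \<Rightarrow> bool" where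
  "RL_feasible m n G \<longleftrightarrow> admissible m n G \<and> RW3_plus G"

definition z_RL :: "nat \<Rightarrow> nat \<Rightarrow> nat" where
  "z_RL m n = Max {num_edges G | G. RL_feasible m n G}"

definition RL_extremal :: "nat \<Rightarrow> nat \<Rightarrow> config \<Rightarrow> bool" where
  "RL_extremal m n G \<longleftrightarrow> RL_feasible m n G \<and> num_edges G = z_RL m n"

text \<open>Vectors of length \<open>m\<close> and \<open>n\<close> are functions on \<open>nat\<close> of which only the entries with index in
  \<open>{1..m}\<close>, respectively \<open>{1..n}\<close>, are used. Real forms are identified with the functions they induce.\<close>

definition bilinear_form ::
  "nat \<Rightarrow> nat \<Rightarrow> (nat \<Rightarrow> nat \<Rightarrow> real) \<Rightarrow> (nat \<Rightarrow> real) \<Rightarrow> (nat \<Rightarrow> real) \<Rightarrow> real" where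
  "bilinear_form m n A x y = (\<Sum>i = 1..m. \<Sum>j = 1..n. A i j * x i * y j)"

definition SOS_rank ::
  "nat \<Rightarrow> nat \<Rightarrow> ((nat \<Rightarrow> real) \<Rightarrow> (nat \<Rightarrow> real) \<Rightarrow> real) \<Rightarrow> nat" where
  "SOS_rank m n P =
     (LEAST r. \<exists>A :: nat \<Rightarrow> nat \<Rightarrow> nat \<Rightarrow> real.
        \<forall>x y. P x y = (\<Sum>t < r. (bilinear_form m n (A t) x y)\<^sup>2))"

text \<open>For a two-edge \<open>e = {(i, j), (k, l)}\<close> with distinct cells the inner sum is \<open>x i * y j + x k * y l\<close>.\<close>

definition config_form :: "config \<Rightarrow> (nat \<Rightarrow> real) \<Rightarrow> (nat \<Rightarrow> real) \<Rightarrow> real" where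
  "config_form G x y =
     (\<Sum>(i, j) \<in> ones G. (x i * y j)\<^sup>2) + (\<Sum>e \<in> twos G. (\<Sum>(i, j) \<in> e. x i * y j)\<^sup>2)"

definition second_order_feasible :: "nat \<Rightarrow> nat \<Rightarrow> config \<Rightarrow> bool" where
  "second_order_feasible m n G \<longleftrightarrow>
     admissible m n G \<and> SOS_rank m n (config_form G) = num_edges G"

definition z_2 :: "nat \<Rightarrow> nat \<Rightarrow> nat" where
  "z_2 m n = Max {num_edges G | G. second_order_feasible m n G}"

end

theory Submission
  imports Defs
begin

text \<open>
  The upper bound is a count of cells. A row of a \<open>C\<^sub>4\<close>-free set with \<open>k\<close> cells uses \<open>k choose 2\<close> pairs of
  columns, no pair of columns is used by two rows, and \<open>k \<le> 1 + (k choose 2)\<close>; with six pairs of columns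
  this gives \<open>z(m, 4) \<le> m + 6\<close>, with equality by the configurations below. Supports are disjoint, so \<open>4 m = (m + 6) + 2 |E\<^sub>2| + H\<close> and therefore
  \<open>2 N + H = 5 m + 6\<close>. Hence \<open>N \<le> (5 m + 6) div 2\<close> for both numbers, and once this value is attained
  every extremal configuration has \<open>H = (5 m + 6) mod 2\<close>. What remains is, for every \<open>m \<ge> 15\<close>, one
  configuration with at most one hole that satisfies RW3+, and the fact that RW3+ forces the SOS rank
  to be \<open>N\<close>.

  For the second point, write a representation of \<open>P\<^sub>G\<close> by \<open>r\<close> squares as a family of vectors in
  \<open>\<real>\<^sup>r\<close>, one for each cell, listing the coefficients at that cell. Comparing coefficients
  turns the representation into identities between inner products (\<open>gram_rep\<close>), and every rule of the
  strengthened closure is a consequence of these identities when \<open>\<sim>\<close> is read as equality of vectors and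
  \<open>\<bottom>\<close> as orthogonality (\<open>closure_sound\<close>). Under RW3+ the selected edges then give \<open>N\<close> orthonormal
  vectors, so \<open>r \<ge> N\<close> (\<open>RW3_plus_SOS_rank\<close>).

  For the first point, the rows are cut into blocks and no two-edge leaves its block. A rectangle has
  only two rows, so what can be derived about an edge of one block and an edge of another depends on these
  two blocks alone. One block of six rows can be repeated any number of times; together with one of six
  starting blocks of 15 to 20 rows it reaches every \<open>m \<ge> 15\<close>. RW3+ of the whole family reduces to
  finitely many derivations, inside a block and between two blocks (\<open>RW3_plus_blocks\<close>). The derivations are
  found by a search that is proved sound (\<open>search_sound\<close>) and evaluated in the logic. The search is cheap because
  every rule has at most one orthogonality premise: a derivation is a chain that alternates between passing
  to the other diagonal of a rectangle and replacing a cell by its partner in the same two-edge.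
\<close>

section \<open>Soundness of the closure for Gram vectors\<close>

definition gram :: "'t set \<Rightarrow> (cell \<Rightarrow> 't \<Rightarrow> real) \<Rightarrow> cell \<Rightarrow> cell \<Rightarrow> real" where
  "gram T v p q = (\<Sum>t\<in>T. v p t * v q t)"

abbreviation delta :: "config \<Rightarrow> cell \<Rightarrow> cell \<Rightarrow> real" where
  "delta G p q \<equiv> of_bool ({p, q} \<in> twos G)"

text \<open>These are the coefficient identities of
  \<open>\<Sum>\<^sub>t (\<Sum>\<^sub>p v p t x\<^sub>i y\<^sub>j)\<^sup>2 = P\<^sub>G(x, y)\<close> with \<open>p = (i, j)\<close>. For a genuine rectangle only the sum over
  both diagonals is prescribed, since both contribute to the monomial \<open>x\<^sub>i x\<^sub>k y\<^sub>j y\<^sub>l\<close>.\<close>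
definition gram_rep :: "config \<Rightarrow> 't set \<Rightarrow> (cell \<Rightarrow> 't \<Rightarrow> real) \<Rightarrow> bool" where
  "gram_rep G T v \<longleftrightarrow> finite T \<and>
     (\<forall>p. gram T v p p = of_bool (p \<in> occupied G)) \<and>
     (\<forall>p q. p \<noteq> q \<longrightarrow> fst p = fst q \<or> snd p = snd q \<longrightarrow> gram T v p q = delta G p q) \<and>
     (\<forall>i k j l. i \<noteq> k \<longrightarrow> j \<noteq> l \<longrightarrow>
        gram T v (i, j) (k, l) + gram T v (i, l) (k, j) = delta G (i, j) (k, l) + delta G (i, l) (k, j))"

lemma gram_sym: "gram T v p q = gram T v q p"
  by (simp add: gram_def mult.commute)

lemma gram_diff: "(\<Sum>t\<in>T. (v p t - v q t)\<^sup>2) = gram T v p p + gram T v q q - 2 * gram T v p q"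
  by (simp add: gram_def power2_eq_square algebra_simps sum.distrib sum_subtractf sum_distrib_left)

text \<open>The equality case of the Cauchy-Schwarz inequality.\<close>
lemma gram_eq_1_imp_eq:
  assumes "finite T" "gram T v p p = 1" "gram T v q q = 1" "gram T v p q = 1" "t \<in> T"
  shows "v p t = v q t"
proof -
  have "(\<Sum>t\<in>T. (v p t - v q t)\<^sup>2) = 0"
    using assms by (simp add: gram_diff)
  then show ?thesis
    using assms(1,5) by (simp add: sum_nonneg_eq_0_iff)
qed

lemma gram_le_1:
  assumes "gram T v p p \<le> 1" "gram T v q q \<le> 1"
  shows "gram T v p q \<le> 1"
proof -
  have "0 \<le> (\<Sum>t\<in>T. (v p t - v q t)\<^sup>2)"
    by (simp add: sum_nonneg)
  then show ?thesis
    using assms by (simp add: gram_diff)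
qed

lemma gram_0:
  assumes "finite T" "gram T v p p = 0"
  shows "gram T v p q = 0"
proof -
  have "\<forall>t\<in>T. v p t = 0"
    using assms by (auto simp: gram_def sum_nonneg_eq_0_iff)
  then show ?thesis by (simp add: gram_def)
qed

lemma in_twos_occupied: "{p, q} \<in> twos G \<Longrightarrow> p \<in> occupied G" "{p, q} \<in> twos G \<Longrightarrow> q \<in> occupied G"
  by (auto simp: occupied_def)

lemma sim_imp_occupied: "sim G p q \<Longrightarrow> p \<in> occupied G \<and> q \<in> occupied G"
  by (induction rule: sim_perp.inducts(1)[where ?P2.0 = "\<lambda>_ _. True"])
    (auto dest: in_twos_occupied)

text \<open>Occupied cells carry unit vectors and all other cells the zero vector. If one diagonal of a
  rectangle has its prescribed inner product, the identity for the rectangle leaves no freedom for the other one.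
  If both diagonals are two-edges, two inner products of unit vectors add up to 2, so both are 1.\<close>
lemma closure_sound:
  assumes "gram_rep G T v"
  shows "sim G p q \<Longrightarrow> gram T v p q = 1"
    and "perp G p q \<Longrightarrow> gram T v p q = 0"
proof (induction rule: sim_perp.inducts)
  note R = assms[unfolded gram_rep_def]
  have fin: "finite T" and diag: "gram T v p p = of_bool (p \<in> occupied G)" for p
    using R by blast+
  have line: "gram T v p q = delta G p q" if "p \<noteq> q" "fst p = fst q \<or> snd p = snd q" for p q
    using R that by blast
  have rect: "gram T v p q + gram T v r s = delta G p q + delta G r s"
    if "i \<noteq> k" "j \<noteq> l" "p = (i, j)" "q = (k, l)" "r = (i, l)" "s = (k, j)" for i k j l p q r s
    using R that by blast
  have hole: "gram T v p q = 0" if "p \<notin> occupied G \<or> q \<notin> occupied G" for p q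
    using that gram_0[OF fin, of v p q] gram_0[OF fin, of v q p] diag
    by (auto simp only: gram_sym[of T v q p] of_bool_eq simp_thms)
  have eq: "v p t = v q t" if "sim G p q" "gram T v p q = 1" "t \<in> T" for p q t
    using gram_eq_1_imp_eq[OF fin, of v p q t] diag[of p] diag[of q]
      sim_imp_occupied[OF that(1)] that(2,3) by simp
  have congr: "gram T v p q = gram T v p' q'"
    if "sim G p p'" "gram T v p p' = 1" "sim G q q'" "gram T v q q' = 1" for p p' q q'
    unfolding gram_def using eq[OF that(1,2)] eq[OF that(3,4)] by (intro sum.cong) auto
  {
    case (sim_refl p)
    then show ?case using diag[of p] by simp
  next
    case (sim_sym p q)
    then show ?case by (simp only: gram_sym)
  next
    case (sim_trans p q r)
    have "r \<in> occupied G" using sim_imp_occupied[OF sim_trans(3)] by blast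
    then have "gram T v p r = gram T v q r"
      using congr[OF sim_trans(1,2) sim_perp.sim_refl] diag[of r] by simp
    then show ?case using sim_trans by simp
  next
    case (perp_sym p q)
    then show ?case by (simp only: gram_sym)
  next
    case (line_perp p q)
    then show ?case using line[of p q] by simp
  next
    case (line_sim p q)
    then show ?case using line[of p q] by simp
  next
    case (saturation p p' q q')
    then show ?case using congr[OF saturation(1,2,3,4)] by simp
  next
    case (transfer_perp i k j l p q r s)
    have "gram T v r s = delta G r s"
      using transfer_perp(7) hole[of r s] by auto
    then show ?case using rect[OF transfer_perp(1-6)] transfer_perp(10) by simp
  next
    case (transfer_sim i k j l p q r s)
    have "gram T v r s = delta G r s"
      using transfer_sim(7) hole[of r s] by auto
    then show ?case using rect[OF transfer_sim(1-6)] transfer_sim(8) by simp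
  next
    case (complementary i k j l)
    have "gram T v (i, j) (k, l) + gram T v (i, l) (k, j) = 2"
      using rect[OF complementary(1,2) refl refl refl refl] complementary(3,4) by simp
    moreover have "gram T v (i, l) (k, j) \<le> 1" "gram T v (i, j) (k, l) \<le> 1"
      using gram_le_1[of T v "(i, l)" "(k, j)"] gram_le_1[of T v "(i, j)" "(k, l)"] by (simp_all only: diag of_bool_less_eq_one simp_thms)
    ultimately show ?case by linarith
  }
qed

text \<open>Bessel's inequality for each coordinate vector \<open>b\<^sub>t\<close> says \<open>\<Sum>\<^sub>e (w\<^sub>e \<bullet> b\<^sub>t)\<^sup>2 \<le> 1\<close>. Summing over
  \<open>t\<close> bounds \<open>\<Sum>\<^sub>e |w\<^sub>e|\<^sup>2 = |E|\<close> by \<open>|T|\<close>.\<close>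
lemma card_orthonormal_le:
  fixes w :: "'e \<Rightarrow> 't \<Rightarrow> real"
  assumes "finite E" "finite T"
    and on: "\<And>e f. e \<in> E \<Longrightarrow> f \<in> E \<Longrightarrow> (\<Sum>t\<in>T. w e t * w f t) = of_bool (e = f)"
  shows "card E \<le> card T"
proof -
  have bessel: "(\<Sum>e\<in>E. (w e t)\<^sup>2) \<le> 1" if t: "t \<in> T" for t
  proof -
    define S where "S = (\<Sum>e\<in>E. (w e t)\<^sup>2)"
    \<comment> \<open>the projection of the coordinate vector \<open>b\<^sub>t\<close> to the span of the family\<close>
    define u where "u s = (\<Sum>e\<in>E. w e t * w e s)" for s
    have "(\<Sum>s\<in>T. (u s)\<^sup>2) = (\<Sum>s\<in>T. \<Sum>e\<in>E. \<Sum>f\<in>E. w e t * w f t * (w e s * w f s))"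
      unfolding u_def power2_eq_square sum_product by (intro sum.cong refl) (simp add: mult_ac)
    also have "\<dots> = (\<Sum>e\<in>E. \<Sum>s\<in>T. \<Sum>f\<in>E. w e t * w f t * (w e s * w f s))"
      by (rule sum.swap)
    also have "\<dots> = (\<Sum>e\<in>E. \<Sum>f\<in>E. \<Sum>s\<in>T. w e t * w f t * (w e s * w f s))"
      by (intro sum.cong refl sum.swap)
    also have "\<dots> = (\<Sum>e\<in>E. \<Sum>f\<in>E. w e t * w f t * of_bool (e = f))"
      by (intro sum.cong refl) (simp add: on flip: sum_distrib_left)
    also have "\<dots> = S"
      unfolding S_def using assms(1) by (intro sum.cong) (auto simp: of_bool_def power2_eq_square sum.delta' if_distrib cong: if_cong)
    finally have uu: "(\<Sum>s\<in>T. (u s)\<^sup>2) = S" .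
    have ut: "u t = S"
      by (simp add: u_def S_def power2_eq_square)
    have "0 \<le> (\<Sum>s\<in>T. (of_bool (s = t) - u s)\<^sup>2)"
      by (simp add: sum_nonneg)
    also have "\<dots> = (\<Sum>s\<in>T. of_bool (s = t) * (1 - 2 * u s)) + (\<Sum>s\<in>T. (u s)\<^sup>2)"
      unfolding sum.distrib[symmetric] by (intro sum.cong) (auto simp: power2_eq_square algebra_simps)
    also have "(\<Sum>s\<in>T. of_bool (s = t) * (1 - 2 * u s)) = (\<Sum>s\<in>T. if s = t then 1 - 2 * u s else 0)"
      by (intro sum.cong) auto
    also have "\<dots> = 1 - 2 * S"
      using t assms(2) by (simp add: ut)
    finally show ?thesis using uu by (simp add: S_def)
  qed
  have "real (card E) = (\<Sum>e\<in>E. \<Sum>t\<in>T. (w e t)\<^sup>2)"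
    using on by (simp add: power2_eq_square)
  also have "\<dots> = (\<Sum>t\<in>T. \<Sum>e\<in>E. (w e t)\<^sup>2)"
    by (rule sum.swap)
  also have "\<dots> \<le> (\<Sum>t\<in>T. 1)"
    using bessel by (intro sum_mono)
  finally show ?thesis by simp
qed

section \<open>Consequences of RW3+\<close>
lemma configuration_finite:
  assumes "configuration m n G"
  shows "finite (ones G)" "finite (twos G)" "finite (edges G)" "occupied G \<subseteq> grid m n"
proof -
  have g: "finite (grid m n)" by (simp add: grid_def)
  show o: "finite (ones G)"
    using assms g finite_subset by (auto simp: configuration_def)
  have "twos G \<subseteq> Pow (grid m n)"
    using assms by (auto simp: configuration_def)
  then show t: "finite (twos G)"
    using g finite_subset by blast
  show "finite (edges G)" using o t by (simp add: edges_def)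
  show "occupied G \<subseteq> grid m n"
    using assms \<open>twos G \<subseteq> Pow (grid m n)\<close> by (auto simp: configuration_def occupied_def)
qed

lemma card_two_edge:
  assumes "configuration m n G" "e \<in> twos G"
  shows "card e = 2"
proof -
  have "e \<in> {{p, q} | p q. p \<in> grid m n \<and> q \<in> grid m n \<and> p \<noteq> q}"
    using assms by (auto simp: configuration_def)
  then show ?thesis by auto
qed

lemma card_edges:
  assumes "configuration m n G"
  shows "card (edges G) = num_edges G"
proof -
  have "(\<lambda>c. {c}) ` ones G \<inter> twos G = {}"
    using card_two_edge[OF assms] by fastforce
  then show ?thesis
    using configuration_finite[OF assms]
    by (simp add: edges_def num_edges_def card_Un_disjoint card_image)
qed

lemma occupied_edges: "p \<in> occupied G \<longleftrightarrow> (\<exists>e\<in>edges G. p \<in> e)"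
  by (auto simp: occupied_def edges_def)

lemma RW3_plus_edge_sim:
  assumes "configuration m n G" "RW3_plus G" "e \<in> edges G" "p \<in> e" "q \<in> e"
  shows "sim G p q"
proof (cases "p = q")
  case True
  then show ?thesis using assms occupied_edges sim_refl by blast
next
  case False
  then have "e \<in> twos G" using assms by (auto simp: edges_def)
  then obtain a b where "e = {a, b}"
    using card_two_edge[OF assms(1)] by (meson card_2_iff)
  then have "e = {p, q}" using False assms(4,5) by blast
  then have "{p, q} \<in> twos G" using \<open>e \<in> twos G\<close> by simp
  then show ?thesis
    using assms(2)[unfolded RW3_plus_def, THEN conjunct1, rule_format] by iprover
qed

lemma RW3_plus_edge_perp:
  assumes "RW3_plus G" "e \<in> edges G" "f \<in> edges G" "e \<noteq> f"
  shows "\<exists>p\<in>e. \<exists>q\<in>f. perp G p q"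
  using assms(1)[unfolded RW3_plus_def, THEN conjunct2, THEN conjunct2, rule_format, OF assms(2-4)] .

text \<open>One vector from each selected edge: the choice within an edge is immaterial because its cells are
  similar, and saturation moves the orthogonality that RW3+ provides to the chosen cells.\<close>
lemma gram_rep_card_ge:
  assumes "configuration m n G" "RW3_plus G" "gram_rep G T v"
  shows "num_edges G \<le> card T"
proof -
  have "e \<noteq> {}" if "e \<in> edges G" for e
    using that card_two_edge[OF assms(1), of e] by (auto simp: edges_def)
  then obtain c where c: "\<And>e. e \<in> edges G \<Longrightarrow> c e \<in> e"
    by (metis ex_in_conv)
  have fT: "finite T" using assms(3) by (simp add: gram_rep_def)
  have "(\<Sum>t\<in>T. v (c e) t * v (c f) t) = of_bool (e = f)" if ef: "e \<in> edges G" "f \<in> edges G" for e f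
  proof (cases "e = f")
    case True
    have "sim G (c e) (c e)" using c ef occupied_edges sim_refl by blast
    then show ?thesis using True closure_sound(1)[OF assms(3), of "c e" "c e"] by (simp add: gram_def)
  next
    case False
    obtain p q where pq: "p \<in> e" "q \<in> f" "perp G p q"
      using RW3_plus_edge_perp[OF assms(2) ef False] by blast
    have "sim G (c e) p" "sim G (c f) q"
      using RW3_plus_edge_sim[OF assms(1,2)] ef pq c by blast+
    then have "perp G (c e) (c f)" using pq saturation by blast
    then show ?thesis using False closure_sound(2)[OF assms(3), of "c e" "c f"] by (simp add: gram_def)
  qed
  then have "card (edges G) \<le> card T"
    using configuration_finite[OF assms(1)] fT by (intro card_orthonormal_le)
  then show ?thesis using card_edges assms(1) by simp
qed

text \<open>The vectors of the defining representation of \<open>P\<^sub>G\<close>, with one coordinate for each edge.\<close>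
definition edge_vec :: "cell \<Rightarrow> cell set \<Rightarrow> real" where
  "edge_vec p e = of_bool (p \<in> e)"

lemma gram_edge_vec:
  assumes "configuration m n G" "simple G"
  shows "gram (edges G) edge_vec p q = of_bool (\<exists>e\<in>edges G. p \<in> e \<and> q \<in> e)"
proof (cases "\<exists>e\<in>edges G. p \<in> e \<and> q \<in> e")
  case True
  then obtain e where e: "e \<in> edges G" "p \<in> e" "q \<in> e" by blast
  have "edge_vec p f * edge_vec q f = (if f = e then 1 else 0)" if "f \<in> edges G" for f
    using that e assms(2) by (auto simp: edge_vec_def simple_def)
  then have "gram (edges G) edge_vec p q = (\<Sum>f\<in>edges G. if f = e then 1 else 0)"
    by (simp add: gram_def)
  then show ?thesis using True e configuration_finite[OF assms(1)] by simp
next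
  case False
  then have "edge_vec p e * edge_vec q e = 0" if "e \<in> edges G" for e
    using that by (simp add: edge_vec_def)
  then have "gram (edges G) edge_vec p q = 0"
    unfolding gram_def by (intro sum.neutral) blast
  then show ?thesis using False by simp
qed

lemma distinct_in_edge:
  assumes "configuration m n G" "p \<noteq> q"
  shows "(\<exists>e\<in>edges G. p \<in> e \<and> q \<in> e) \<longleftrightarrow> {p, q} \<in> twos G"
proof
  assume "\<exists>e\<in>edges G. p \<in> e \<and> q \<in> e"
  then obtain e where e: "e \<in> edges G" "p \<in> e" "q \<in> e" by blast
  then have "e \<in> twos G" using assms(2) by (auto simp: edges_def)
  moreover obtain a b where "e = {a, b}"
    using card_two_edge[OF assms(1) \<open>e \<in> twos G\<close>] by (meson card_2_iff)
  then have "e = {p, q}" using e assms(2) by blast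
  ultimately show "{p, q} \<in> twos G" by simp
next
  assume "{p, q} \<in> twos G"
  then show "\<exists>e\<in>edges G. p \<in> e \<and> q \<in> e"
    by (intro bexI[of _ "{p, q}"]) (auto simp: edges_def)
qed

lemma gram_rep_edge_vec:
  assumes "configuration m n G" "simple G"
  shows "gram_rep G (edges G) edge_vec"
proof -
  have "gram (edges G) edge_vec p p = of_bool (p \<in> occupied G)" for p
    by (simp add: gram_edge_vec[OF assms] occupied_edges)
  moreover have "gram (edges G) edge_vec p q = delta G p q" if "p \<noteq> q" for p q
    by (simp only: gram_edge_vec[OF assms] distinct_in_edge[OF assms(1) that])
  ultimately show ?thesis
    using configuration_finite[OF assms(1)] by (simp add: gram_rep_def)
qed

text \<open>Soundness for the configuration's own vectors: similar cells have the same vector, and the vector of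
  an occupied cell determines its edge.\<close>
lemma sim_same_edge:
  assumes "configuration m n G" "simple G" "sim G p q"
  shows "\<exists>e\<in>edges G. p \<in> e \<and> q \<in> e"
  using closure_sound(1)[OF gram_rep_edge_vec[OF assms(1,2)] assms(3)]
  by (simp add: gram_edge_vec[OF assms(1,2)])

text \<open>Similarity classes of different edges are different by \<open>sim_same_edge\<close>, so certified two-edges and
  certified orthogonality of any two edges suffice for RW3+.\<close>
lemma RW3_plusI:
  assumes "configuration m n G" "simple G"
    and "\<And>p q. {p, q} \<in> twos G \<Longrightarrow> sim G p q"
    and "\<And>e f. e \<in> edges G \<Longrightarrow> f \<in> edges G \<Longrightarrow> e \<noteq> f \<Longrightarrow> \<exists>p\<in>e. \<exists>q\<in>f. perp G p q"
  shows "RW3_plus G"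
proof -
  have "sim_class G p \<noteq> sim_class G q"
    if "e \<in> edges G" "f \<in> edges G" "e \<noteq> f" "p \<in> e" "q \<in> f" for e f p q
  proof
    assume *: "sim_class G p = sim_class G q"
    have "q \<in> occupied G" using that occupied_edges by blast
    then have "q \<in> sim_class G p" unfolding * by (simp add: sim_class_def sim_refl)
    then obtain g where "g \<in> edges G" "p \<in> g" "q \<in> g"
      using sim_same_edge[OF assms(1,2), of p q] unfolding sim_class_def by blast
    moreover from this have "g = e" "g = f"
      using assms(2) that by (auto simp: simple_def)
    ultimately show False using that by simp
  qed
  with assms(3,4) show ?thesis
    unfolding RW3_plus_def by (intro conjI allI ballI impI)
qed

section \<open>The SOS rank under RW3+\<close>
definition bilin :: "nat \<Rightarrow> nat \<Rightarrow> (cell \<Rightarrow> real) \<Rightarrow> (nat \<Rightarrow> real) \<Rightarrow> (nat \<Rightarrow> real) \<Rightarrow> real" where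
  "bilin m n w x y = bilinear_form m n (\<lambda>i j. w (i, j)) x y"

lemma bilin_eq: "bilin m n w x y = (\<Sum>p\<in>grid m n. w p * (x (fst p) * y (snd p)))"
  unfolding bilin_def bilinear_form_def grid_def
  by (simp add: sum.cartesian_product case_prod_beta mult_ac)

lemma config_form_eq:
  assumes "configuration m n G"
  shows "config_form G x y = (\<Sum>e\<in>edges G. (bilin m n (\<lambda>p. edge_vec p e) x y)\<^sup>2)"
proof -
  have fin: "finite (grid m n)" by (simp add: grid_def)
  have b: "bilin m n (\<lambda>p. edge_vec p e) x y = (\<Sum>(i, j)\<in>e. x i * y j)" if "e \<subseteq> grid m n" for e
  proof -
    have "bilin m n (\<lambda>p. edge_vec p e) x y = (\<Sum>p\<in>grid m n. if p \<in> e then x (fst p) * y (snd p) else 0)"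
      unfolding bilin_eq by (intro sum.cong) (auto simp: edge_vec_def)
    also have "\<dots> = (\<Sum>p\<in>e. x (fst p) * y (snd p))"
      using fin that by (simp add: sum.inter_restrict[symmetric] Int_absorb1)
    finally show ?thesis by (simp add: case_prod_beta)
  qed
  have sub: "e \<subseteq> grid m n" if "e \<in> edges G" for e
    using that assms by (auto simp: edges_def configuration_def)
  have disj: "(\<lambda>c. {c}) ` ones G \<inter> twos G = {}"
    using card_two_edge[OF assms] by fastforce
  have "(\<Sum>e\<in>edges G. (bilin m n (\<lambda>p. edge_vec p e) x y)\<^sup>2) = (\<Sum>e\<in>edges G. (\<Sum>(i, j)\<in>e. x i * y j)\<^sup>2)"
    using b sub by (intro sum.cong) auto
  also have "\<dots> = (\<Sum>e\<in>(\<lambda>c. {c}) ` ones G. (\<Sum>(i, j)\<in>e. x i * y j)\<^sup>2) + (\<Sum>e\<in>twos G. (\<Sum>(i, j)\<in>e. x i * y j)\<^sup>2)"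
    unfolding edges_def using disj configuration_finite[OF assms] by (intro sum.union_disjoint) auto
  also have "(\<Sum>e\<in>(\<lambda>c. {c}) ` ones G. (\<Sum>(i, j)\<in>e. x i * y j)\<^sup>2) = (\<Sum>(i, j)\<in>ones G. (x i * y j)\<^sup>2)"
    by (simp add: sum.reindex case_prod_beta)
  finally show ?thesis by (simp add: config_form_def)
qed

lemma bilin_indicator:
  assumes "\<And>p. p \<notin> grid m n \<Longrightarrow> w p = 0" "finite X" "finite Y"
  shows "bilin m n w (\<lambda>i. of_bool (i \<in> X)) (\<lambda>j. of_bool (j \<in> Y)) = (\<Sum>p\<in>X \<times> Y. w p)"
proof -
  have "bilin m n w (\<lambda>i. of_bool (i \<in> X)) (\<lambda>j. of_bool (j \<in> Y))
    = (\<Sum>p\<in>grid m n. if p \<in> X \<times> Y then w p else 0)"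
    unfolding bilin_eq by (intro sum.cong) (auto simp: mem_Times_iff)
  also have "\<dots> = (\<Sum>p\<in>grid m n \<inter> X \<times> Y. w p)"
    by (simp add: grid_def sum.inter_restrict)
  also have "\<dots> = (\<Sum>p\<in>X \<times> Y. w p)"
    using assms by (intro sum.mono_neutral_left) auto
  finally show ?thesis .
qed

text \<open>Polarization: the inner products on which \<open>gram_rep\<close> depends are linear combinations of values of the
  sum of squares at 0/1 vectors. Hence they are determined by the function.\<close>
lemma sum_squares_indicator:
  fixes v :: "cell \<Rightarrow> 't \<Rightarrow> real" and T :: "'t set"
  assumes v0: "\<forall>p t. p \<notin> grid m n \<longrightarrow> v p t = 0"
    and "i \<noteq> k" "j \<noteq> l"
    and F_def: "\<And>X Y. F X Y = (\<Sum>t\<in>T. (bilin m n (\<lambda>p. v p t) (\<lambda>i. of_bool (i \<in> X)) (\<lambda>j. of_bool (j \<in> Y)))\<^sup>2)"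
  shows "gram T v (i, j) (i, j) = F {i} {j}"
    and "2 * gram T v (i, j) (i, l) = F {i} {j, l} - F {i} {j} - F {i} {l}"
    and "2 * gram T v (i, j) (k, j) = F {i, k} {j} - F {i} {j} - F {k} {j}"
    and "2 * (gram T v (i, j) (k, l) + gram T v (i, l) (k, j)) =
      F {i, k} {j, l} - F {i, k} {j} - F {i, k} {l} - F {i} {j, l} - F {k} {j, l}
        + F {i} {j} + F {i} {l} + F {k} {j} + F {k} {l}"
proof -
  have F: "F X Y = (\<Sum>t\<in>T. (\<Sum>p\<in>X \<times> Y. v p t)\<^sup>2)" if "finite X" "finite Y" for X Y
  proof -
    have "bilin m n (\<lambda>p. v p t) (\<lambda>i. of_bool (i \<in> X)) (\<lambda>j. of_bool (j \<in> Y)) = (\<Sum>p\<in>X \<times> Y. v p t)" for t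
      by (rule bilin_indicator[OF _ that]) (use v0 in blast)
    then show ?thesis by (simp add: F_def)
  qed
  have prods: "{i} \<times> {j} = {(i, j)}" "{i} \<times> {j, l} = {(i, j), (i, l)}" "{i, k} \<times> {j} = {(i, j), (k, j)}"
    "{i, k} \<times> {j, l} = {(i, j), (i, l), (k, j), (k, l)}" for i j k l :: nat
    by auto
  note s = F prods gram_def power2_eq_square algebra_simps sum.distrib sum_distrib_left
  show "gram T v (i, j) (i, j) = F {i} {j}"
    by (simp add: s)
  show "2 * gram T v (i, j) (i, l) = F {i} {j, l} - F {i} {j} - F {i} {l}"
    using assms(2,3) by (simp add: s)
  show "2 * gram T v (i, j) (k, j) = F {i, k} {j} - F {i} {j} - F {k} {j}"
    using assms(2,3) by (simp add: s)
  show "2 * (gram T v (i, j) (k, l) + gram T v (i, l) (k, j)) =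
      F {i, k} {j, l} - F {i, k} {j} - F {i, k} {l} - F {i} {j, l} - F {k} {j, l}
        + F {i} {j} + F {i} {l} + F {k} {j} + F {k} {l}"
    using assms(2,3) by (simp add: s)
qed

text \<open>Two families of squares with the same sum satisfy the same coefficient identities.\<close>
lemma gram_rep_cong:
  assumes v: "\<forall>p t. p \<notin> grid m n \<longrightarrow> v p t = 0" and u: "\<forall>p t. p \<notin> grid m n \<longrightarrow> u p t = 0"
    and "finite T" and rep: "gram_rep G S u"
    and eq: "\<And>x y. (\<Sum>t\<in>T. (bilin m n (\<lambda>p. v p t) x y)\<^sup>2) = (\<Sum>t\<in>S. (bilin m n (\<lambda>p. u p t) x y)\<^sup>2)"
  shows "gram_rep G T v"
proof -
  define F where "F X Y = (\<Sum>t\<in>T. (bilin m n (\<lambda>p. v p t) (\<lambda>i. of_bool (i \<in> X)) (\<lambda>j. of_bool (j \<in> Y)))\<^sup>2)" for X Y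
  have F_u: "F X Y = (\<Sum>t\<in>S. (bilin m n (\<lambda>p. u p t) (\<lambda>i. of_bool (i \<in> X)) (\<lambda>j. of_bool (j \<in> Y)))\<^sup>2)" for X Y
    by (simp only: F_def eq)
  note sv = sum_squares_indicator[where m = m and n = n, OF _ _ _ F_def, OF v]
  note su = sum_squares_indicator[where m = m and n = n, OF _ _ _ F_u, OF u]
  have 1: "gram T v (i, j) (i, j) = gram S u (i, j) (i, j)" for i j
    using sv(1)[of i "Suc i" j "Suc j"] su(1)[of i "Suc i" j "Suc j"] by simp
  have 2: "gram T v (i, j) (i, l) = gram S u (i, j) (i, l)" if "j \<noteq> l" for i j l
    using sv(2)[of i "Suc i" j l] su(2)[of i "Suc i" j l] that by simp
  have 3: "gram T v (i, j) (k, j) = gram S u (i, j) (k, j)" if "i \<noteq> k" for i j k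
    using sv(3)[of i k j "Suc j"] su(3)[of i k j "Suc j"] that by simp
  have 4: "gram T v (i, j) (k, l) + gram T v (i, l) (k, j) = gram S u (i, j) (k, l) + gram S u (i, l) (k, j)"
    if "i \<noteq> k" "j \<noteq> l" for i j k l
    using trans[OF sv(4)[OF that] su(4)[OF that, symmetric]] by (simp only: mult_cancel_left) simp
  have diag: "gram T v p p = gram S u p p" for p
    using 1 by (cases p) simp
  have line: "gram T v p q = gram S u p q" if "p \<noteq> q" "fst p = fst q \<or> snd p = snd q" for p q
    using 2 3 that by (cases p; cases q) auto
  note rep' = rep[unfolded gram_rep_def]
  show ?thesis
    unfolding gram_rep_def
  proof (intro conjI allI impI)
    show "gram T v p p = of_bool (p \<in> occupied G)" for p
      unfolding diag using rep' by blast
    show "gram T v p q = delta G p q" if "p \<noteq> q" "fst p = fst q \<or> snd p = snd q" for p q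
      unfolding line[OF that] using rep' that by blast
    show "gram T v (i, j) (k, l) + gram T v (i, l) (k, j) = delta G (i, j) (k, l) + delta G (i, l) (k, j)"
      if "i \<noteq> k" "j \<noteq> l" for i j k l
      unfolding 4[OF that] using rep' that by blast
  qed fact
qed

text \<open>The defining representation has \<open>N\<close> squares. The vectors of any other one form a Gram
  representation as well, so \<open>gram_rep_card_ge\<close> applies to them.\<close>
lemma RW3_plus_SOS_rank:
  assumes "configuration m n G" "simple G" "RW3_plus G"
  shows "SOS_rank m n (config_form G) = num_edges G"
  unfolding SOS_rank_def
proof (rule Least_equality)
  have fin: "finite (edges G)" using configuration_finite assms(1) by blast
  obtain h where h: "bij_betw h {..<num_edges G} (edges G)"
    using ex_bij_betw_nat_finite[OF fin] card_edges[OF assms(1)] by (metis atLeast0LessThan)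
  have "config_form G x y = (\<Sum>t<num_edges G. (bilinear_form m n (\<lambda>i j. edge_vec (i, j) (h t)) x y)\<^sup>2)" for x y
    unfolding config_form_eq[OF assms(1)] bilin_def
    using sum.reindex_bij_betw[OF h, of "\<lambda>e. (bilinear_form m n (\<lambda>i j. edge_vec (i, j) e) x y)\<^sup>2"] by simp
  then show "\<exists>A. \<forall>x y. config_form G x y = (\<Sum>t<num_edges G. (bilinear_form m n (A t) x y)\<^sup>2)"
    by (intro exI[of _ "\<lambda>t i j. edge_vec (i, j) (h t)"]) blast
next
  fix r :: nat
  assume "\<exists>A. \<forall>x y. config_form G x y = (\<Sum>t<r. (bilinear_form m n (A t) x y)\<^sup>2)"
  then obtain A where A: "\<And>x y. config_form G x y = (\<Sum>t<r. (bilinear_form m n (A t) x y)\<^sup>2)"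
    by blast
  define v where "v p t = (if p \<in> grid m n then A t (fst p) (snd p) else 0)" for p t
  have v: "bilin m n (\<lambda>p. v p t) x y = bilinear_form m n (A t) x y" for t x y
    unfolding bilin_def bilinear_form_def by (intro sum.cong) (auto simp: v_def grid_def)
  have sub: "e \<subseteq> grid m n" if "e \<in> edges G" for e
    using that assms(1) by (auto simp: edges_def configuration_def)
  define u where "u p e = (if e \<in> edges G then edge_vec p e else 0)" for p e
  have rep: "gram_rep G (edges G) u"
    using gram_rep_edge_vec[OF assms(1,2)] by (simp add: gram_rep_def gram_def u_def)
  have eq: "(\<Sum>t<r. (bilin m n (\<lambda>p. v p t) x y)\<^sup>2) = (\<Sum>e\<in>edges G. (bilin m n (\<lambda>p. u p e) x y)\<^sup>2)" for x y
    using A[of x y] config_form_eq[OF assms(1), of x y] by (simp add: v u_def)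
  have v0: "\<forall>p t. p \<notin> grid m n \<longrightarrow> v p t = 0"
    unfolding v_def by presburger
  have u0: "\<forall>p e. p \<notin> grid m n \<longrightarrow> u p e = 0"
  proof (intro allI impI)
    show "u p e = 0" if "p \<notin> grid m n" for p e
      using sub[of e] that by (auto simp: u_def edge_vec_def)
  qed
  have "gram_rep G {..<r} v"
    by (rule gram_rep_cong[OF v0 u0 finite_lessThan rep eq])
  from gram_rep_card_ge[OF assms(1,3) this] show "num_edges G \<le> r" by simp
qed

section \<open>Counting cells\<close>
lemma finite_grid: "finite (grid m n)"
  by (simp add: grid_def)

text \<open>Pairs of columns occupied by different rows are different, and a row with \<open>k\<close> cells occupies
  \<open>k choose 2 \<ge> k - 1\<close> of them.\<close>
lemma C4_free_card_le:
  assumes "S \<subseteq> grid m n" "C4_free S"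
  shows "card S \<le> m + (n choose 2)"
proof -
  define R where "R i = {j. (i, j) \<in> S}" for i
  define Q where "Q i = {B. B \<subseteq> R i \<and> card B = 2}" for i
  have R: "R i \<subseteq> {1..n}" for i
    using assms(1) by (auto simp: R_def grid_def)
  then have finR: "finite (R i)" for i
    using finite_subset by blast
  have "card S = card (SIGMA i:{1..m}. R i)"
    using assms(1) by (intro arg_cong[of _ _ card]) (auto simp: R_def grid_def)
  also have "\<dots> = (\<Sum>i\<in>{1..m}. card (R i))"
    using finR by simp
  also have "\<dots> \<le> (\<Sum>i\<in>{1..m}. 1 + (card (R i) choose 2))"
  proof (rule sum_mono)
    have "k \<le> 1 + (k choose 2)" for k :: nat
      by (induction k) (auto simp: numeral_2_eq_2)
    then show "card (R i) \<le> 1 + (card (R i) choose 2)" for i .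
  qed
  also have "\<dots> = m + (\<Sum>i\<in>{1..m}. card (Q i))"
    unfolding sum.distrib using finR by (simp add: Q_def n_subsets)
  also have "(\<Sum>i\<in>{1..m}. card (Q i)) = card (\<Union>i\<in>{1..m}. Q i)"
  proof (rule card_UN_disjoint[symmetric])
    show "\<forall>i\<in>{1..m}. finite (Q i)"
      using finR by (simp add: Q_def)
    have "Q i \<inter> Q k = {}" if "i \<noteq> k" for i k
    proof -
      have False if "B \<in> Q i" "B \<in> Q k" for B
      proof -
        have B: "card B = 2" "B \<subseteq> R i" "B \<subseteq> R k"
          using that by (simp_all add: Q_def)
        obtain j l where "B = {j, l}" "j \<noteq> l"
          using B(1) by (meson card_2_iff)
        then have "(i, j) \<in> S" "(k, l) \<in> S" "(i, l) \<in> S" "(k, j) \<in> S"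
          using B(2,3) by (simp_all add: R_def)
        then show False
          using assms(2)[unfolded C4_free_def] \<open>i \<noteq> k\<close> \<open>j \<noteq> l\<close> by blast
      qed
      then show ?thesis by blast
    qed
    then show "\<forall>i\<in>{1..m}. \<forall>k\<in>{1..m}. i \<noteq> k \<longrightarrow> Q i \<inter> Q k = {}"
      by blast
  qed simp
  also have "card (\<Union>i\<in>{1..m}. Q i) \<le> card {B. B \<subseteq> {1..n} \<and> card B = 2}"
    using R by (intro card_mono) (auto simp: Q_def)
  also have "\<dots> = n choose 2"
    by (simp add: n_subsets)
  finally show ?thesis by simp
qed

lemma zarankiewicz_eqI:
  assumes "S \<subseteq> grid m n" "C4_free S" "card S = m + (n choose 2)"
  shows "zarankiewicz m n = m + (n choose 2)"
  unfolding zarankiewicz_def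
proof (rule Max_eqI)
  show "finite {card S | S. S \<subseteq> grid m n \<and> C4_free S}"
    by (rule finite_subset[of _ "{..m + (n choose 2)}"]) (auto intro: C4_free_card_le)
  show "m + (n choose 2) \<in> {card S | S. S \<subseteq> grid m n \<and> C4_free S}"
    using assms by (metis (mono_tags, lifting) mem_Collect_eq)
qed (auto intro: C4_free_card_le)

lemma card_grid_eq:
  assumes "configuration m n G" "simple G"
  shows "m * n = num_holes m n G + card (ones G) + 2 * card (twos G)"
proof -
  note fin = configuration_finite[OF assms(1)]
  have disj: "e \<inter> f = {}" if "e \<in> twos G" "f \<in> edges G" "e \<noteq> f" for e f
    using assms(2)[unfolded simple_def, rule_format, of e f] that by (simp add: edges_def)
  have "card (\<Union>(twos G)) = (\<Sum>e\<in>twos G. card e)"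
  proof (rule card_Union_disjoint)
    show "pairwise disjnt (twos G)"
      using disj by (intro pairwiseI) (simp add: disjnt_def edges_def)
    show "finite e" if "e \<in> twos G" for e
      using card_two_edge[OF assms(1) that] by (intro card_ge_0_finite) simp
  qed
  also have "\<dots> = (\<Sum>e\<in>twos G. 2)"
    by (intro sum.cong refl card_two_edge[OF assms(1)])
  finally have twos: "card (\<Union>(twos G)) = 2 * card (twos G)" by simp
  have "c \<notin> e" if "c \<in> ones G" "e \<in> twos G" for c e
  proof
    assume "c \<in> e"
    moreover have "e \<noteq> {c}" using card_two_edge[OF assms(1) that(2)] by auto
    ultimately show False
      using disj[of e "{c}"] that by (auto simp: edges_def)
  qed
  then have "ones G \<inter> \<Union>(twos G) = {}" by blast
  moreover have "finite (\<Union>(twos G))"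
    using fin(4) finite_grid finite_subset by (auto simp: occupied_def)
  ultimately have "card (occupied G) = card (ones G) + 2 * card (twos G)"
    using fin(1) twos by (simp add: occupied_def card_Un_disjoint)
  moreover have "num_holes m n G + card (occupied G) = card (grid m n)"
    using card_Diff_subset[of "occupied G" "grid m n"] card_mono[OF finite_grid fin(4)]
      finite_subset[OF fin(4) finite_grid] fin(4) by (simp add: num_holes_def)
  moreover have "card (grid m n) = m * n" by (simp add: grid_def)
  ultimately show ?thesis by simp
qed

section \<open>Configurations given by a partner function\<close>

(* Cells stay atomic: the rules for pairs would split every quantifier over cells. *)
declare split_paired_All [simp del] split_paired_Ex [simp del]

text \<open>An involution on the occupied cells: its fixed points are the one-edges and its orbits of size two
  are the two-edges. Simplicity is built into this encoding.\<close>
definition partner_config :: "(cell \<Rightarrow> cell option) \<Rightarrow> config" where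
  "partner_config \<mu> = \<lparr>ones = {p. \<mu> p = Some p}, twos = {{p, q} | p q. p \<noteq> q \<and> \<mu> p = Some q}\<rparr>"

definition involutive :: "(cell \<Rightarrow> cell option) \<Rightarrow> bool" where
  "involutive \<mu> \<longleftrightarrow> (\<forall>p q. \<mu> p = Some q \<longrightarrow> \<mu> q = Some p)"

lemma involutiveD: "involutive \<mu> \<Longrightarrow> \<mu> p = Some q \<Longrightarrow> \<mu> q = Some p"
  unfolding involutive_def by iprover

lemma twos_partner_config:
  assumes "involutive \<mu>"
  shows "{p, q} \<in> twos (partner_config \<mu>) \<longleftrightarrow> p \<noteq> q \<and> \<mu> p = Some q"
proof
  assume "{p, q} \<in> twos (partner_config \<mu>)"
  then obtain a b where "{p, q} = {a, b}" "a \<noteq> b" "\<mu> a = Some b"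
    unfolding partner_config_def by auto
  then show "p \<noteq> q \<and> \<mu> p = Some q"
    using involutiveD[OF assms, of a b] by (metis doubleton_eq_iff)
next
  assume "p \<noteq> q \<and> \<mu> p = Some q"
  then show "{p, q} \<in> twos (partner_config \<mu>)"
    unfolding partner_config_def by simp blast
qed

lemma edges_partner_config:
  "e \<in> edges (partner_config \<mu>) \<longleftrightarrow> (\<exists>p q. \<mu> p = Some q \<and> e = {p, q})"
proof
  assume "e \<in> edges (partner_config \<mu>)"
  then consider p where "\<mu> p = Some p" "e = {p}" | p q where "\<mu> p = Some q" "e = {p, q}"
    unfolding edges_def partner_config_def by auto
  then show "\<exists>p q. \<mu> p = Some q \<and> e = {p, q}"
    by cases (metis insert_absorb2, metis)
next
  assume "\<exists>p q. \<mu> p = Some q \<and> e = {p, q}"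
  then obtain p q where "\<mu> p = Some q" "e = {p, q}" by metis
  then show "e \<in> edges (partner_config \<mu>)"
    by (cases "p = q") (auto simp: edges_def partner_config_def)
qed

lemma occupied_partner_config:
  assumes "involutive \<mu>"
  shows "p \<in> occupied (partner_config \<mu>) \<longleftrightarrow> \<mu> p \<noteq> None"
proof
  assume "p \<in> occupied (partner_config \<mu>)"
  then obtain e where "e \<in> edges (partner_config \<mu>)" "p \<in> e"
    unfolding occupied_edges by blast
  then obtain a b where "\<mu> a = Some b" "p = a \<or> p = b"
    unfolding edges_partner_config by blast
  then show "\<mu> p \<noteq> None"
    using involutiveD[OF assms, of a b] by auto
next
  assume "\<mu> p \<noteq> None"
  then obtain q where "\<mu> p = Some q" by blast
  then show "p \<in> occupied (partner_config \<mu>)"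
    unfolding occupied_edges
    by (intro bexI[of _ "{p, q}"] insertI1) (unfold edges_partner_config, iprover)
qed

lemma edge_of_partner_config:
  assumes "involutive \<mu>" "e \<in> edges (partner_config \<mu>)" "p \<in> e"
  shows "\<exists>q. \<mu> p = Some q \<and> e = {p, q}"
proof -
  obtain a b where ab: "\<mu> a = Some b" "e = {a, b}"
    using assms(2) unfolding edges_partner_config by metis
  then show ?thesis
    using involutiveD[OF assms(1) ab(1)] assms(3) by (metis insertE insert_commute singletonD)
qed

lemma simple_partner_config:
  assumes "involutive \<mu>"
  shows "simple (partner_config \<mu>)"
  unfolding simple_def
proof (intro ballI impI)
  fix e f assume ef: "e \<in> edges (partner_config \<mu>)" "f \<in> edges (partner_config \<mu>)" "e \<noteq> f"
  have "False" if "p \<in> e" "p \<in> f" for p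
    using edge_of_partner_config[OF assms ef(1) that(1)] edge_of_partner_config[OF assms ef(2) that(2)] ef(3)
    by auto
  then show "e \<inter> f = {}" by blast
qed

section \<open>Tables and the search for derivations\<close>

text \<open>A table describes a block of four columns, with rows and columns counted from 0. A cell of a two-edge
  records its partner and a rank; the two-edges are certified in the order of their ranks.\<close>
datatype slot = Empty | Single | Paired cell nat

type_synonym table = "slot list list"

definition slot_at :: "table \<Rightarrow> cell \<Rightarrow> slot" where
  "slot_at T p = T ! fst p ! snd p"

definition partner :: "table \<Rightarrow> cell \<Rightarrow> cell option" where
  "partner T p = (case slot_at T p of Empty \<Rightarrow> None | Single \<Rightarrow> Some p | Paired q a \<Rightarrow> Some q)"

definition in_table :: "table \<Rightarrow> cell \<Rightarrow> bool" where
  "in_table T p \<longleftrightarrow> fst p < length T \<and> snd p < 4"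

definition valid :: "table \<Rightarrow> bool" where
  "valid T \<longleftrightarrow> (\<forall>p q. in_table T p \<longrightarrow> partner T p = Some q \<longrightarrow> in_table T q \<and> partner T q = Some p)"

text \<open>From here on \<open>p\<close> lies in a first block and \<open>q\<close> in a second one; the flag \<open>same\<close> tells
  whether the two blocks coincide. Cells of different blocks never share a row.\<close>
definition on_line :: "bool \<Rightarrow> cell \<Rightarrow> cell \<Rightarrow> bool" where
  "on_line same p q \<longleftrightarrow> snd p = snd q \<or> same \<and> fst p = fst q"

text \<open>Whether the diagonal \<open>r\<close>, \<open>s\<close> has its prescribed value, where \<open>C\<close> selects the ranks that are
  already certified and \<open>P\<close> decides orthogonality after a jump from \<open>r\<close> or \<open>s\<close> to a partner. Staying at
  both cells is not an option, as it would lead back to the target diagonal. Conditionals take the place of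
  connectives because rewriting evaluates them lazily.\<close>
definition companion_ok ::
  "bool \<Rightarrow> table \<Rightarrow> table \<Rightarrow> (nat \<Rightarrow> bool) \<Rightarrow> (cell \<Rightarrow> cell \<Rightarrow> bool) \<Rightarrow> cell \<Rightarrow> cell \<Rightarrow> bool" where
  "companion_ok same S T C P r s =
     (case slot_at S r of
        Empty \<Rightarrow> True
      | Single \<Rightarrow> (case slot_at T s of
            Empty \<Rightarrow> True
          | Single \<Rightarrow> False
          | Paired s' b \<Rightarrow> if C b then P r s' else False)
      | Paired r' a \<Rightarrow> (case slot_at T s of
            Empty \<Rightarrow> True
          | Single \<Rightarrow> if C a then P r' s else False
          | Paired s' b \<Rightarrow>
              if same \<and> r' = s then C a
              else if if C a then P r' s else False then True
              else if C b then if P r s' then True else if C a then P r' s' else False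
              else False))"

text \<open>The number \<open>d\<close> bounds the length of the chain.\<close>
primrec search ::
  "bool \<Rightarrow> table \<Rightarrow> table \<Rightarrow> (nat \<Rightarrow> bool) \<Rightarrow> nat \<Rightarrow> cell \<Rightarrow> cell \<Rightarrow> bool" where
  "search same S T C 0 p q = on_line same p q"
| "search same S T C (Suc d) p q =
     (if on_line same p q then True
      else companion_ok same S T C (search same S T C d) (fst p, snd q) (fst q, snd p))"

text \<open>The grid counts rows and columns from 1, and \<open>s\<close> is the number of rows above the block.\<close>
definition place :: "nat \<Rightarrow> cell \<Rightarrow> cell" where
  "place s p = (Suc (s + fst p), Suc (snd p))"

definition placed :: "(cell \<Rightarrow> cell option) \<Rightarrow> table \<Rightarrow> nat \<Rightarrow> bool" where
  "placed \<mu> T s \<longleftrightarrow> valid T \<and> (\<forall>p. in_table T p \<longrightarrow> \<mu> (place s p) = map_option (place s) (partner T p))"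

lemma placedD: "placed \<mu> T s \<Longrightarrow> in_table T p \<Longrightarrow> \<mu> (place s p) = map_option (place s) (partner T p)"
  unfolding placed_def by iprover

lemma validD:
  assumes "valid T" "in_table T p" "partner T p = Some q"
  shows "in_table T q" "partner T q = Some p"
  using assms unfolding valid_def by iprover+

lemma place_eq_iff [simp]: "place s p = place s q \<longleftrightarrow> p = q"
  by (auto simp: place_def prod_eq_iff)

text \<open>In what follows \<open>C\<close> is either \<open>\<lambda>b. b < a\<close>, while the two-edge of rank \<open>a\<close> is being certified, or
  constantly true, once all two-edges are.\<close>
definition certified :: "(cell \<Rightarrow> cell option) \<Rightarrow> table \<Rightarrow> nat \<Rightarrow> (nat \<Rightarrow> bool) \<Rightarrow> bool" where
  "certified \<mu> T s C \<longleftrightarrow> (\<forall>p q a. in_table T p \<longrightarrow> slot_at T p = Paired q a \<longrightarrow> C a \<longrightarrow>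
     sim (partner_config \<mu>) (place s p) (place s q))"

text \<open>The relative position of two blocks starting below the rows \<open>s\<close> and \<open>t\<close>: they are the same block
  or have disjoint sets of rows.\<close>
definition apart :: "bool \<Rightarrow> table \<Rightarrow> nat \<Rightarrow> table \<Rightarrow> nat \<Rightarrow> bool" where
  "apart same S s T t \<longleftrightarrow>
     (if same then S = T \<and> s = t else s + length S \<le> t \<or> t + length T \<le> s)"

locale placed_pair =
  fixes \<mu> :: "cell \<Rightarrow> cell option" and S T :: table and s t :: nat and same :: bool
  assumes inv: "involutive \<mu>"
    and S: "placed \<mu> S s" and T: "placed \<mu> T t"
    and apart: "apart same S s T t"
begin

abbreviation "G \<equiv> partner_config \<mu>"

text \<open>The premise of the two transfer rules about the companion diagonal.\<close>
definition certified_value :: "cell \<Rightarrow> cell \<Rightarrow> bool" where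
  "certified_value r q \<longleftrightarrow>
     ({r, q} \<notin> twos G \<and> (r \<notin> occupied G \<or> q \<notin> occupied G \<or> perp G r q)) \<or>
     ({r, q} \<in> twos G \<and> sim G r q)"

lemma partner_place_S: "in_table S p \<Longrightarrow> \<mu> (place s p) = map_option (place s) (partner S p)"
  and partner_place_T: "in_table T p \<Longrightarrow> \<mu> (place t p) = map_option (place t) (partner T p)"
  using placedD S T by blast+

lemma valid_S: "valid S" and valid_T: "valid T"
  using S T by (simp_all add: placed_def)

lemma row_eq:
  assumes "in_table S p" "in_table T q" "fst (place s p) = fst (place t q)"
  shows "same \<and> fst p = fst q"
  using apart assms by (cases same) (auto simp: apart_def in_table_def place_def)

lemma place_ST:
  assumes "in_table S p" "in_table T q"
  shows "place s p = place t q \<longleftrightarrow> same \<and> p = q"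
proof
  assume "place s p = place t q"
  then show "same \<and> p = q"
    using row_eq[OF assms] by (auto simp: place_def prod_eq_iff)
qed (use apart in \<open>auto simp: apart_def\<close>)

lemma twos_ST:
  assumes "in_table S p" "in_table T q"
  shows "{place s p, place t q} \<in> twos G \<longleftrightarrow> same \<and> p \<noteq> q \<and> partner S p = Some q"
proof -
  have "\<mu> (place s p) = Some (place t q) \<longleftrightarrow> same \<and> partner S p = Some q"
  proof (cases "partner S p")
    case None
    then show ?thesis using partner_place_S[OF assms(1)] by simp
  next
    case (Some r)
    then have "in_table S r" using validD[OF valid_S assms(1)] by simp
    then show ?thesis
      using Some partner_place_S[OF assms(1)] place_ST[OF _ assms(2)] by auto
  qed
  then show ?thesis
    using twos_partner_config[OF inv] place_ST[OF assms] by metis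
qed

lemma occupied_S: "in_table S p \<Longrightarrow> place s p \<in> occupied G \<longleftrightarrow> slot_at S p \<noteq> Empty"
  using partner_place_S occupied_partner_config[OF inv] by (simp add: partner_def split: slot.split)

lemma occupied_T: "in_table T p \<Longrightarrow> place t p \<in> occupied G \<longleftrightarrow> slot_at T p \<noteq> Empty"
  using partner_place_T occupied_partner_config[OF inv] by (simp add: partner_def split: slot.split)

lemma transfer_rule:
  assumes "in_table S p" "in_table T q" "\<not> on_line same p q"
    and "certified_value (place s (fst p, snd q)) (place t (fst q, snd p))"
    and "slot_at S p \<noteq> Empty" "slot_at T q \<noteq> Empty"
  shows "if {place s p, place t q} \<in> twos G then sim G (place s p) (place t q)
    else perp G (place s p) (place t q)"
proof -
  let ?i = "Suc (s + fst p)" and ?k = "Suc (t + fst q)" and ?j = "Suc (snd p)" and ?l = "Suc (snd q)"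
  have "?i \<noteq> ?k"
    using row_eq[OF assms(1,2)] assms(3) by (auto simp: place_def on_line_def)
  moreover have "?j \<noteq> ?l"
    using assms(3) by (simp add: on_line_def)
  moreover have "place s p = (?i, ?j)" "place t q = (?k, ?l)"
    "place s (fst p, snd q) = (?i, ?l)" "place t (fst q, snd p) = (?k, ?j)"
    by (simp_all add: place_def)
  moreover have "place s p \<in> occupied G" "place t q \<in> occupied G"
    using occupied_S occupied_T assms by simp_all
  ultimately show ?thesis
    using transfer_perp[of ?i ?k ?j ?l "place s p" "place t q" "place s (fst p, snd q)" "place t (fst q, snd p)" G]
      transfer_sim[of ?i ?k ?j ?l "place s p" "place t q" "place s (fst p, snd q)" "place t (fst q, snd p)" G]
      assms(4) unfolding certified_value_def by simp
qed

text \<open>The two cells belong to different edges. Jumps to a partner preserve this, so along a chain the target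
  of the search is always an orthogonality.\<close>
definition apart_cells :: "cell \<Rightarrow> cell \<Rightarrow> bool" where
  "apart_cells p q \<longleftrightarrow> in_table S p \<and> in_table T q \<and> slot_at S p \<noteq> Empty \<and> slot_at T q \<noteq> Empty \<and>
     \<not> (same \<and> (p = q \<or> partner S p = Some q))"

lemma same_table: "same \<Longrightarrow> T = S" "same \<Longrightarrow> t = s"
  using apart by (simp_all add: apart_def)

lemma jump_S:
  assumes "apart_cells p q" "slot_at S p = Paired p' a"
  shows "apart_cells p' q"
proof -
  have p: "in_table S p" "partner S p = Some p'"
    using assms by (simp_all add: apart_cells_def partner_def)
  note p' = validD[OF valid_S p]
  have "slot_at S p' \<noteq> Empty"
    using p'(2) by (auto simp: partner_def)
  then show ?thesis
    using assms(1) p p' by (auto simp: apart_cells_def)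
qed

lemma jump_T:
  assumes "apart_cells p q" "slot_at T q = Paired q' b"
  shows "apart_cells p q'"
proof -
  have q: "in_table T q" "partner T q = Some q'"
    using assms by (simp_all add: apart_cells_def partner_def)
  note q' = validD[OF valid_T q]
  have "slot_at T q' \<noteq> Empty"
    using q'(2) by (auto simp: partner_def)
  moreover have "\<not> (same \<and> (p = q' \<or> partner S p = Some q'))"
    using assms(1) q q'(2) validD(2)[OF valid_S, of p q'] same_table
    by (auto simp: apart_cells_def)
  ultimately show ?thesis
    using assms(1) q'(1) by (simp add: apart_cells_def)
qed

lemma sim_S:
  assumes "certified \<mu> S s C" "in_table S p" "slot_at S p = Paired p' a" "C a"
  shows "sim G (place s p) (place s p')"
  using assms unfolding certified_def by iprover

lemma sim_T:
  assumes "certified \<mu> T t C" "in_table T q" "slot_at T q = Paired q' a" "C a"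
  shows "sim G (place t q) (place t q')"
  using assms unfolding certified_def by iprover

text \<open>If the diagonal is a two-edge of the block, its rank is tested; in all other cases a jump is justified by
  saturation with a certified two-edge.\<close>
lemma companion_ok_sound:
  assumes C: "certified \<mu> S s C" "certified \<mu> T t C"
    and P: "\<And>p q. apart_cells p q \<Longrightarrow> P p q \<Longrightarrow> perp G (place s p) (place t q)"
    and rq: "in_table S r" "in_table T q" and ne: "\<not> (same \<and> r = q)"
    and ok: "companion_ok same S T C P r q"
  shows "certified_value (place s r) (place t q)"
proof (cases "slot_at S r = Empty \<or> slot_at T q = Empty")
  case True
  then have "place s r \<notin> occupied G \<or> place t q \<notin> occupied G"
    using occupied_S[OF rq(1)] occupied_T[OF rq(2)] by blast
  moreover from this have "{place s r, place t q} \<notin> twos G"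
    using in_twos_occupied by blast
  ultimately show ?thesis
    unfolding certified_value_def by blast
next
  case occ: False
  show ?thesis
  proof (cases "same \<and> partner S r = Some q")
    case True
    then obtain a where a: "slot_at S r = Paired q a"
      using ne by (auto simp: partner_def split: slot.splits)
    moreover obtain b where "slot_at T q = Paired r b"
      using True validD(2)[OF valid_S rq(1), of q] same_table ne
      by (auto simp: partner_def split: slot.splits)
    ultimately have "C a"
      using ok True by (simp add: companion_ok_def)
    then have "sim G (place s r) (place t q)"
      using sim_S[OF C(1) rq(1) a] True same_table by simp
    moreover have "{place s r, place t q} \<in> twos G"
      using twos_ST[OF rq] True ne by simp
    ultimately show ?thesis
      unfolding certified_value_def by blast
  next
    case False
    then have rq': "apart_cells r q"
      using rq ne occ by (simp add: apart_cells_def)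
    have refl: "sim G (place s r) (place s r)" "sim G (place t q) (place t q)"
      using occ occupied_S[OF rq(1)] occupied_T[OF rq(2)] sim_refl by simp_all
    have 1: "perp G (place s r) (place t q)" if "slot_at S r = Paired r' a" "C a" "P r' q" for r' a
      using saturation[OF sim_S[OF C(1) rq(1) that(1,2)] refl(2) P[OF jump_S[OF rq' that(1)] that(3)]] .
    have 2: "perp G (place s r) (place t q)" if "slot_at T q = Paired q' b" "C b" "P r q'" for q' b
      using saturation[OF refl(1) sim_T[OF C(2) rq(2) that(1,2)] P[OF jump_T[OF rq' that(1)] that(3)]] .
    have 3: "perp G (place s r) (place t q)"
      if "slot_at S r = Paired r' a" "C a" "slot_at T q = Paired q' b" "C b" "P r' q'" for r' a q' b
      using saturation[OF sim_S[OF C(1) rq(1) that(1,2)] sim_T[OF C(2) rq(2) that(3,4)]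
          P[OF jump_T[OF jump_S[OF rq' that(1)] that(3)] that(5)]] .
    have "perp G (place s r) (place t q)"
    proof (cases "slot_at S r")
      case Empty
      then show ?thesis using occ by simp
    next
      case Single
      then obtain q' b where "slot_at T q = Paired q' b" "C b" "P r q'"
        using ok occ by (cases "slot_at T q") (simp_all add: companion_ok_def split: if_splits)
      then show ?thesis using 2 by blast
    next
      case r: (Paired r' a)
      have r': "\<not> (same \<and> r' = q)" using False r by (simp add: partner_def)
      show ?thesis
      proof (cases "slot_at T q")
        case Empty
        then show ?thesis using occ by simp
      next
        case Single
        then have "C a" "P r' q"
          using ok r by (simp_all add: companion_ok_def split: if_splits)
        then show ?thesis using 1 r by blast
      next
        case q: (Paired q' b)
        have "(C a \<and> P r' q) \<or> (C b \<and> P r q') \<or> (C a \<and> C b \<and> P r' q')"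
          using ok r' by (simp add: companion_ok_def r q split: if_splits)
        then show ?thesis using 1[OF r] 2[OF q] 3[OF r _ q] by blast
      qed
    qed
    moreover have "{place s r, place t q} \<notin> twos G"
      using twos_ST[OF rq] False by simp
    ultimately show ?thesis
      unfolding certified_value_def by blast
  qed
qed

lemma perp_on_line:
  assumes "apart_cells p q" "on_line same p q"
  shows "perp G (place s p) (place t q)"
proof (rule line_perp)
  have pq: "in_table S p" "in_table T q" using assms by (simp_all add: apart_cells_def)
  show "place s p \<in> occupied G" "place t q \<in> occupied G"
    using occupied_S[OF pq(1)] occupied_T[OF pq(2)] assms(1) by (simp_all add: apart_cells_def)
  show "place s p \<noteq> place t q" "{place s p, place t q} \<notin> twos G"
    using place_ST[OF pq] twos_ST[OF pq] assms(1) by (auto simp: apart_cells_def)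
  show "fst (place s p) = fst (place t q) \<or> snd (place s p) = snd (place t q)"
    using assms(2) same_table by (auto simp: on_line_def place_def)
qed

lemma search_sound:
  assumes C: "certified \<mu> S s C" "certified \<mu> T t C"
  shows "apart_cells p q \<Longrightarrow> search same S T C d p q \<Longrightarrow> perp G (place s p) (place t q)"
proof (induction d arbitrary: p q)
  case 0
  then show ?case using perp_on_line by simp
next
  case (Suc d)
  show ?case
  proof (cases "on_line same p q")
    case True
    then show ?thesis using perp_on_line Suc.prems(1) by blast
  next
    case False
    let ?r = "(fst p, snd q)" and ?q = "(fst q, snd p)"
    have pq: "in_table S p" "in_table T q" "slot_at S p \<noteq> Empty" "slot_at T q \<noteq> Empty"
      using Suc.prems(1) by (simp_all add: apart_cells_def)
    have "certified_value (place s ?r) (place t ?q)"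
    proof (rule companion_ok_sound[OF C, where P = "search same S T C d"])
      show "in_table S ?r" "in_table T ?q"
        using pq by (simp_all add: in_table_def)
      show "\<not> (same \<and> ?r = ?q)"
        using False by (auto simp: on_line_def)
      show "companion_ok same S T C (search same S T C d) ?r ?q"
        using Suc.prems(2) False by simp
    qed (rule Suc.IH)
    then show ?thesis
      using transfer_rule[OF pq(1,2) False _ pq(3,4)] twos_ST[OF pq(1,2)] Suc.prems(1)
      by (auto simp: apart_cells_def)
  qed
qed

end

section \<open>From tables to RW3+\<close>
definition table_cells :: "table \<Rightarrow> cell list" where
  "table_cells T = List.product [0..<length T] [0..<4]"

lemma set_table_cells: "p \<in> set (table_cells T) \<longleftrightarrow> in_table T p"
  by (cases p) (auto simp: table_cells_def in_table_def)

definition cell_certifiable :: "nat \<Rightarrow> table \<Rightarrow> cell \<Rightarrow> bool" where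
  "cell_certifiable d T p = (case slot_at T p of
       Empty \<Rightarrow> True
     | Single \<Rightarrow> True
     | Paired q a \<Rightarrow>
         if on_line True p q then True
         else if partner T (fst p, snd q) = Some (fst q, snd p) then True
         else companion_ok True T T (\<lambda>b. b < a) (search True T T (\<lambda>b. b < a) d) (fst p, snd q) (fst q, snd p))"

definition certifiable :: "nat \<Rightarrow> table \<Rightarrow> bool" where
  "certifiable d T \<longleftrightarrow> list_all (cell_certifiable d T) (table_cells T)"

text \<open>Induction on the rank: the search for the two-edge of rank \<open>a\<close> only jumps along two-edges of
  smaller rank.\<close>
lemma certifiable_sound:
  assumes inv: "involutive \<mu>" and T: "placed \<mu> T s" and cert: "certifiable d T"
  shows "certified \<mu> T s (\<lambda>_. True)"
proof -
  interpret placed_pair \<mu> T T s s True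
    by unfold_locales (use inv T in \<open>simp_all add: apart_def\<close>)
  have "certified \<mu> T s (\<lambda>b. b < a)" for a
  proof (induction a)
    case 0
    then show ?case by (simp add: certified_def)
  next
    case (Suc a)
    have "sim G (place s p) (place s q)" if p: "in_table T p" "slot_at T p = Paired q a" for p q
    proof (cases "p = q")
      case True
      then show ?thesis using occupied_S[OF p(1)] p(2) sim_refl by simp
    next
      case False
      have q: "partner T p = Some q" using p(2) by (simp add: partner_def)
      note q' = validD[OF valid_S p(1) q]
      have tw: "{place s p, place s q} \<in> twos G"
        using twos_ST[OF p(1) q'(1)] q False by simp
      have ok: "cell_certifiable d T p"
        using cert p(1) by (simp add: certifiable_def list_all_iff set_table_cells)
      let ?r = "(fst p, snd q)" and ?q = "(fst q, snd p)"
      have rq: "in_table T ?r" "in_table T ?q"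
        using p(1) q'(1) by (simp_all add: in_table_def)
      consider "on_line True p q" | "\<not> on_line True p q" "partner T ?r = Some ?q"
        | "\<not> on_line True p q" "companion_ok True T T (\<lambda>b. b < a) (search True T T (\<lambda>b. b < a) d) ?r ?q"
        using ok p(2) by (auto simp: cell_certifiable_def split: if_splits)
      then show ?thesis
      proof cases
        case 1
        then have "fst (place s p) = fst (place s q) \<or> snd (place s p) = snd (place s q)"
          by (auto simp: on_line_def place_def)
        then show ?thesis
          using line_sim[OF in_twos_occupied[OF tw] _ _ tw] False by simp
      next
        case 2
        then have "?r \<noteq> ?q" by (auto simp: on_line_def)
        then have "{place s ?r, place s ?q} \<in> twos G"
          using twos_ST[OF rq] 2 by simp
        moreover have "fst (place s p) \<noteq> fst (place s q)" "snd (place s p) \<noteq> snd (place s q)"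
          using 2(1) by (simp_all add: on_line_def place_def)
        ultimately show ?thesis
          using complementary[of "fst (place s p)" "fst (place s q)" "snd (place s p)" "snd (place s q)" G] tw
          by (simp add: place_def)
      next
        case 3
        have "\<not> (True \<and> ?r = ?q)" using 3(1) by (auto simp: on_line_def)
        from companion_ok_sound[OF Suc Suc search_sound[OF Suc Suc] rq this 3(2)]
        have "certified_value (place s ?r) (place s ?q)" .
        then show ?thesis
          using transfer_rule[OF p(1) q'(1) 3(1)] tw occupied_S[OF q'(1)] in_twos_occupied[OF tw] p(2) by simp
      qed
    qed
    then have step: "certified \<mu> T s (\<lambda>b. b = a)"
      by (simp add: certified_def)
    show ?case
      unfolding certified_def
    proof (intro allI impI)
      fix p q b assume "in_table T p" "slot_at T p = Paired q b" "b < Suc a"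
      then show "sim G (place s p) (place s q)"
        using sim_S[OF Suc, of p q b] sim_S[OF step, of p q b] by linarith
    qed
  qed
  then show ?thesis
    unfolding certified_def by (metis lessI)
qed

definition edge_cells :: "table \<Rightarrow> cell \<Rightarrow> cell list" where
  "edge_cells T p = (case slot_at T p of Empty \<Rightarrow> [] | Single \<Rightarrow> [p] | Paired q a \<Rightarrow> [p, q])"

text \<open>The lexicographic order singles out one cell of each two-edge as its representative.\<close>
definition before :: "cell \<Rightarrow> cell \<Rightarrow> bool" where
  "before p q \<longleftrightarrow> fst p < fst q \<or> fst p = fst q \<and> snd p < snd q"

definition representatives :: "table \<Rightarrow> cell list" where
  "representatives T = filter (\<lambda>p. case slot_at T p of Empty \<Rightarrow> False | Single \<Rightarrow> True | Paired q a \<Rightarrow> before p q) (table_cells T)"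

text \<open>An existential test on lists that rewriting stops at the first witness.\<close>
fun lazy_any :: "('a \<Rightarrow> bool) \<Rightarrow> 'a list \<Rightarrow> bool" where
  "lazy_any P [] = False"
| "lazy_any P (x # xs) = (if P x then True else lazy_any P xs)"

lemma lazy_any_iff: "lazy_any P xs \<longleftrightarrow> (\<exists>x\<in>set xs. P x)"
  by (induction xs) auto

definition edges_perp :: "bool \<Rightarrow> nat \<Rightarrow> table \<Rightarrow> table \<Rightarrow> cell \<Rightarrow> cell \<Rightarrow> bool" where
  "edges_perp same d S T p q = lazy_any (\<lambda>p'. lazy_any (search same S T (\<lambda>_. True) d p') (edge_cells T q)) (edge_cells S p)"

definition perp_within :: "nat \<Rightarrow> table \<Rightarrow> bool" where
  "perp_within d T \<longleftrightarrow> sorted_wrt (edges_perp True d T T) (representatives T)"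

definition perp_between :: "nat \<Rightarrow> table \<Rightarrow> table \<Rightarrow> bool" where
  "perp_between d S T \<longleftrightarrow> list_all (\<lambda>p. list_all (edges_perp False d S T p) (representatives T)) (representatives S)"

lemma representativesD:
  assumes "p \<in> set (representatives T)"
  shows "in_table T p" "slot_at T p \<noteq> Empty" "slot_at T p = Paired q a \<Longrightarrow> before p q"
  using assms by (auto simp: representatives_def set_table_cells)

text \<open>Partners lie in the table, differ, and point to each other with the same rank.\<close>
definition well_formed :: "table \<Rightarrow> bool" where
  "well_formed T \<longleftrightarrow> list_all (\<lambda>p. case slot_at T p of
       Empty \<Rightarrow> True
     | Single \<Rightarrow> True
     | Paired q a \<Rightarrow> if in_table T q then if before p q \<or> before q p then slot_at T q = Paired p a else False else False)
     (table_cells T)"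

lemma well_formedD:
  assumes "well_formed T" "in_table T p" "slot_at T p = Paired q a"
  shows "in_table T q" "before p q \<or> before q p" "slot_at T q = Paired p a"
  using assms unfolding well_formed_def list_all_iff set_table_cells[symmetric]
  by (auto split: if_splits dest!: bspec[of _ _ p])

lemma well_formed_valid:
  assumes "well_formed T"
  shows "valid T"
  unfolding valid_def
proof (intro allI impI)
  fix p q assume p: "in_table T p" "partner T p = Some q"
  show "in_table T q \<and> partner T q = Some p"
  proof (cases "slot_at T p")
    case (Paired r a)
    then show ?thesis
      using well_formedD[OF assms p(1) Paired] p(2) by (simp add: partner_def)
  qed (use p in \<open>simp_all add: partner_def\<close>)
qed

lemma rep_exists:
  assumes "well_formed T" "in_table T p" "partner T p = Some q"
  shows "\<exists>r\<in>set (representatives T). set (edge_cells T r) = {p, q}"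
proof (cases "slot_at T p")
  case Empty
  then show ?thesis using assms(3) by (simp add: partner_def)
next
  case Single
  then have "p \<in> set (representatives T)" "set (edge_cells T p) = {p, q}"
    using assms(2,3) by (simp_all add: representatives_def set_table_cells partner_def edge_cells_def)
  then show ?thesis by blast
next
  case (Paired q' a)
  then have [simp]: "q' = q" using assms(3) by (simp add: partner_def)
  note q = well_formedD[OF assms(1,2) Paired]
  show ?thesis
  proof (cases "before p q")
    case True
    then have "p \<in> set (representatives T)" "set (edge_cells T p) = {p, q}"
      using Paired assms(2) by (simp_all add: representatives_def set_table_cells edge_cells_def)
    then show ?thesis by blast
  next
    case False
    then have "q \<in> set (representatives T)" "set (edge_cells T q) = {p, q}"
      using q by (auto simp: representatives_def set_table_cells edge_cells_def)
    then show ?thesis by blast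
  qed
qed

lemma before_asym: "before p q \<Longrightarrow> \<not> before q p"
  by (auto simp: before_def)

context placed_pair
begin

lemma edges_perp_sound:
  assumes C: "certified \<mu> S s (\<lambda>_. True)" "certified \<mu> T t (\<lambda>_. True)"
    and wf: "well_formed S"
    and pq: "p \<in> set (representatives S)" "q \<in> set (representatives T)" "\<not> (same \<and> p = q)"
    and perp: "edges_perp same d S T p q"
  shows "\<exists>p'\<in>set (edge_cells S p). \<exists>q'\<in>set (edge_cells T q). perp G (place s p') (place t q')"
proof -
  note p = representativesD[OF pq(1)] and q = representativesD[OF pq(2)]
  have "\<not> (same \<and> partner S p = Some q)"
  proof
    assume *: "same \<and> partner S p = Some q"
    then obtain a where a: "slot_at S p = Paired q a"
      using p(2) pq(3) by (auto simp: partner_def split: slot.splits)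
    then have "slot_at T q = Paired p a"
      using well_formedD(3)[OF wf p(1) a] * same_table by simp
    then show False
      using p(3)[OF a] q(3) before_asym by blast
  qed
  then have pq': "apart_cells p q"
    using p(1,2) q(1,2) pq(3) by (auto simp: apart_cells_def)
  have S': "apart_cells p' x" if "p' \<in> set (edge_cells S p)" "apart_cells p x" for p' x
    using that jump_S[OF that(2)] by (auto simp: edge_cells_def split: slot.splits)
  have T': "apart_cells x q'" if "q' \<in> set (edge_cells T q)" "apart_cells x q" for q' x
    using that jump_T[OF that(2)] by (auto simp: edge_cells_def split: slot.splits)
  obtain p' q' where "p' \<in> set (edge_cells S p)" "q' \<in> set (edge_cells T q)"
      "search same S T (\<lambda>_. True) d p' q'"
    using perp by (auto simp: edges_perp_def lazy_any_iff)
  then show ?thesis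
    using search_sound[OF C T'[OF _ S'[OF _ pq']]] by blast
qed

end

text \<open>Each edge lies in one block and has a representative there, so a pair of edges is settled by a search
  inside one block or between two blocks.\<close>
lemma RW3_plus_blocks:
  assumes inv: "involutive \<mu>" and conf: "configuration m n (partner_config \<mu>)"
    and blocks: "\<And>T s. (T, s) \<in> Bs \<Longrightarrow> placed \<mu> T s \<and> well_formed T \<and> certifiable d T \<and> perp_within d T"
    and cover: "\<And>p. \<mu> p \<noteq> None \<Longrightarrow> \<exists>T s q. (T, s) \<in> Bs \<and> in_table T q \<and> p = place s q"
    and cross: "\<And>S s T t. (S, s) \<in> Bs \<Longrightarrow> (T, t) \<in> Bs \<Longrightarrow> (S, s) \<noteq> (T, t) \<Longrightarrow>
      apart False S s T t \<and> (perp_between d S T \<or> perp_between d T S)"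
  shows "RW3_plus (partner_config \<mu>)"
proof (rule RW3_plusI[OF conf simple_partner_config[OF inv]])
  let ?G = "partner_config \<mu>"
  have cert: "certified \<mu> T s (\<lambda>_. True)" if "(T, s) \<in> Bs" for T s
    using certifiable_sound[OF inv] blocks[OF that] by blast
  show "sim ?G p q" if "{p, q} \<in> twos ?G" for p q
  proof -
    have pq: "p \<noteq> q" "\<mu> p = Some q"
      using that twos_partner_config[OF inv] by simp_all
    then obtain T s r where r: "(T, s) \<in> Bs" "in_table T r" "p = place s r"
      using cover[of p] by auto
    then have "map_option (place s) (partner T r) = Some q"
      using placedD[of \<mu> T s r] blocks[OF r(1)] pq(2) by simp
    then obtain r' where r': "partner T r = Some r'" "q = place s r'" by auto
    then obtain a where "slot_at T r = Paired r' a"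
      using pq(1) r(3) by (auto simp: partner_def split: slot.splits)
    then show ?thesis
      using cert[OF r(1)] r(2,3) r'(2) unfolding certified_def by simp
  qed
  have rep: "\<exists>T s r. (T, s) \<in> Bs \<and> r \<in> set (representatives T) \<and> e = place s ` set (edge_cells T r)"
    if e: "e \<in> edges ?G" for e
  proof -
    obtain p q where pq: "\<mu> p = Some q" "e = {p, q}"
      using e edges_partner_config[of e \<mu>] by metis
    then obtain T s r where r: "(T, s) \<in> Bs" "in_table T r" "p = place s r"
      using cover[of p] by auto
    then have "map_option (place s) (partner T r) = Some q"
      using placedD[of \<mu> T s r] blocks[OF r(1)] pq(1) by simp
    then obtain r' where r': "partner T r = Some r'" "q = place s r'" by auto
    obtain r0 where "r0 \<in> set (representatives T)" "set (edge_cells T r0) = {r, r'}"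
      using rep_exists[OF _ r(2) r'(1)] blocks[OF r(1)] by blast
    then show ?thesis
      using r(1,3) r'(2) pq(2) by (intro exI[of _ T] exI[of _ s] exI[of _ r0]) simp
  qed
  show "\<exists>p\<in>e. \<exists>q\<in>f. perp ?G p q" if ef: "e \<in> edges ?G" "f \<in> edges ?G" "e \<noteq> f" for e f
  proof -
    obtain S s p where p: "(S, s) \<in> Bs" "p \<in> set (representatives S)" "e = place s ` set (edge_cells S p)"
      using rep[OF ef(1)] by metis
    obtain T t q where q: "(T, t) \<in> Bs" "q \<in> set (representatives T)" "f = place t ` set (edge_cells T q)"
      using rep[OF ef(2)] by metis
    note bS = blocks[OF p(1)] and bT = blocks[OF q(1)]
    have pair: "\<exists>p'\<in>set (edge_cells S p). \<exists>q'\<in>set (edge_cells T q). perp ?G (place s p') (place t q')"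
      if "apart same S s T t" "\<not> (same \<and> p = q)" "edges_perp same d S T p q" for same
    proof -
      interpret placed_pair \<mu> S T s t same
        by unfold_locales (use inv bS bT that in simp_all)
      show ?thesis
        using edges_perp_sound[OF cert[OF p(1)] cert[OF q(1)] _ p(2) q(2) that(2,3)] bS by blast
    qed
    have pair': "\<exists>p'\<in>set (edge_cells S p). \<exists>q'\<in>set (edge_cells T q). perp ?G (place s p') (place t q')"
      if "apart same T t S s" "\<not> (same \<and> q = p)" "edges_perp same d T S q p" for same
    proof -
      interpret placed_pair \<mu> T S t s same
        by unfold_locales (use inv bS bT that in simp_all)
      show ?thesis
        using edges_perp_sound[OF cert[OF q(1)] cert[OF p(1)] _ q(2) p(2) that(2,3)] bT perp_sym by blast
    qed
    have "\<exists>p'\<in>set (edge_cells S p). \<exists>q'\<in>set (edge_cells T q). perp ?G (place s p') (place t q')"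
    proof (cases "(S, s) = (T, t)")
      case True
      then have "p \<noteq> q" using ef(3) p(3) q(3) by auto
      then have "edges_perp True d S T p q \<or> edges_perp True d T S q p"
        using bS True p(2) q(2) unfolding perp_within_def
        by (auto simp: sorted_wrt_iff_nth_less in_set_conv_nth) (metis linorder_neqE_nat)
      then show ?thesis
        using pair[of True] pair'[of True] True \<open>p \<noteq> q\<close> by (auto simp: apart_def)
    next
      case False
      then have "apart False S s T t" "apart False T t S s"
        "edges_perp False d S T p q \<or> edges_perp False d T S q p"
        using cross[OF p(1) q(1)] p(2) q(2) by (auto simp: perp_between_def list_all_iff apart_def)
      then show ?thesis using pair[of False] pair'[of False] by blast
    qed
    then show ?thesis using p(3) q(3) by blast
  qed
qed

section \<open>Stacking blocks\<close>
definition single_columns :: "table \<Rightarrow> nat \<Rightarrow> nat list" where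
  "single_columns T i = filter (\<lambda>j. slot_at T (i, j) = Single) [0..<4]"

lemma set_single_columns: "set (single_columns T i) = {j. j < 4 \<and> slot_at T (i, j) = Single}"
  by (auto simp: single_columns_def)

lemma distinct_single_columns: "distinct (single_columns T i)"
  by (simp add: single_columns_def)

definition empty_cells :: "table \<Rightarrow> cell list" where
  "empty_cells T = filter (\<lambda>p. slot_at T p = Empty) (table_cells T)"

lemma set_empty_cells: "set (empty_cells T) = {p. in_table T p \<and> slot_at T p = Empty}"
  by (auto simp: empty_cells_def set_table_cells)

text \<open>A stack is a set of pairs of a table and the number of rows above it.\<close>
definition located :: "(table \<times> nat) set \<Rightarrow> cell \<Rightarrow> table \<times> nat \<times> cell \<Rightarrow> bool" where
  "located Bs p x \<longleftrightarrow> (case x of (T, s, q) \<Rightarrow> (T, s) \<in> Bs \<and> in_table T q \<and> p = place s q)"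

definition glue :: "(table \<times> nat) set \<Rightarrow> cell \<Rightarrow> cell option" where
  "glue Bs p = (if \<exists>x. located Bs p x
     then case SOME x. located Bs p x of (T, s, q) \<Rightarrow> map_option (place s) (partner T q)
     else None)"

locale block_system =
  fixes Bs :: "(table \<times> nat) set" and m :: nat
  assumes wf: "(T, s) \<in> Bs \<Longrightarrow> well_formed T"
    and sep: "(S, s) \<in> Bs \<Longrightarrow> (T, t) \<in> Bs \<Longrightarrow> (S, s) \<noteq> (T, t) \<Longrightarrow> apart False S s T t"
    and fits: "(T, s) \<in> Bs \<Longrightarrow> s + length T \<le> m"
    and rows: "1 \<le> i \<Longrightarrow> i \<le> m \<Longrightarrow> \<exists>T s. (T, s) \<in> Bs \<and> s < i \<and> i \<le> s + length T"
begin

abbreviation "G \<equiv> partner_config (glue Bs)"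

lemma located_unique:
  assumes "located Bs p (S, s, q)" "located Bs p (T, t, r)"
  shows "S = T \<and> s = t \<and> q = r"
proof -
  have 1: "(S, s) \<in> Bs" "in_table S q" "p = place s q" and 2: "(T, t) \<in> Bs" "in_table T r" "p = place t r"
    using assms by (simp_all add: located_def)
  have "Suc (s + fst q) = Suc (t + fst r)"
    using 1(3) 2(3) by (simp add: place_def)
  then have "\<not> apart False S s T t"
    using 1(2) 2(2) by (auto simp: apart_def in_table_def)
  then have "(S, s) = (T, t)"
    using sep[OF 1(1) 2(1)] by blast
  then show ?thesis using 1(3) 2(3) by simp
qed

lemma glue_place:
  assumes "(T, s) \<in> Bs" "in_table T q"
  shows "glue Bs (place s q) = map_option (place s) (partner T q)"
proof -
  have loc: "located Bs (place s q) (T, s, q)"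
    using assms by (simp add: located_def)
  have "(SOME x. located Bs (place s q) x) = (T, s, q)"
  proof (rule some_equality[of "located Bs (place s q)", OF loc])
    fix x assume x: "located Bs (place s q) x"
    obtain S r c where "x = (S, r, c)" by (cases x)
    then show "x = (T, s, q)"
      using located_unique[OF _ loc] x by blast
  qed
  moreover have "\<exists>x. located Bs (place s q) x" using loc by (rule exI)
  ultimately show ?thesis by (simp add: glue_def)
qed

lemma glue_cover:
  assumes "glue Bs p \<noteq> None"
  shows "\<exists>T s q. (T, s) \<in> Bs \<and> in_table T q \<and> p = place s q"
proof -
  obtain x where "located Bs p x"
    using assms unfolding glue_def by presburger
  then show ?thesis by (cases x) (auto simp: located_def)
qed

lemma placed_glue: "(T, s) \<in> Bs \<Longrightarrow> placed (glue Bs) T s"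
  using glue_place well_formed_valid[OF wf] by (simp add: placed_def)

lemma involutive_glue: "involutive (glue Bs)"
  unfolding involutive_def
proof (intro allI impI)
  fix p q assume pq: "glue Bs p = Some q"
  then obtain T s r where r: "(T, s) \<in> Bs" "in_table T r" "p = place s r"
    using glue_cover[of p] by auto
  then obtain r' where r': "partner T r = Some r'" "q = place s r'"
    using pq glue_place[OF r(1,2)] by auto
  note v = validD[OF well_formed_valid[OF wf[OF r(1)]] r(2) r'(1)]
  show "glue Bs q = Some p"
    using glue_place[OF r(1) v(1)] v(2) r(3) r'(2) by simp
qed

lemma place_in_grid: "(T, s) \<in> Bs \<Longrightarrow> in_table T q \<Longrightarrow> place s q \<in> grid m 4"
  using fits[of T s] by (auto simp: place_def in_table_def grid_def)

lemma grid_cell: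
  assumes "p \<in> grid m 4"
  shows "\<exists>T s q. (T, s) \<in> Bs \<and> in_table T q \<and> p = place s q"
proof -
  obtain i j where p: "p = (i, j)" "1 \<le> i" "i \<le> m" "1 \<le> j" "j \<le> 4"
    using assms by (auto simp: grid_def)
  obtain T s where T: "(T, s) \<in> Bs" "s < i" "i \<le> s + length T"
    using rows[OF p(2,3)] by blast
  have "in_table T (i - s - 1, j - 1)" "p = place s (i - s - 1, j - 1)"
    using p T(2,3) by (auto simp: in_table_def place_def)
  then show ?thesis using T(1) by blast
qed

lemma glue_in_grid: "glue Bs p = Some q \<Longrightarrow> p \<in> grid m 4"
  using glue_cover[of p] place_in_grid by auto

lemma configuration_glue: "configuration m 4 G"
  unfolding configuration_def
proof
  show "ones G \<subseteq> grid m 4"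
    using glue_in_grid by (auto simp: partner_config_def)
  show "twos G \<subseteq> {{p, q} | p q. p \<in> grid m 4 \<and> q \<in> grid m 4 \<and> p \<noteq> q}"
  proof
    fix e assume "e \<in> twos G"
    then obtain p q where "e = {p, q}" "p \<noteq> q" "glue Bs p = Some q"
      by (auto simp: partner_config_def)
    moreover from this have "p \<in> grid m 4" "q \<in> grid m 4"
      using glue_in_grid involutiveD[OF involutive_glue] by blast+
    ultimately show "e \<in> {{p, q} | p q. p \<in> grid m 4 \<and> q \<in> grid m 4 \<and> p \<noteq> q}" by blast
  qed
qed

text \<open>A two-edge never has itself as partner in a well-formed table, so fixed points come from single cells only.\<close>
lemma ones_place:
  assumes "(T, s) \<in> Bs" "in_table T q"
  shows "place s q \<in> ones G \<longleftrightarrow> slot_at T q = Single"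
proof -
  have "place s q \<in> ones G \<longleftrightarrow> partner T q = Some q"
    using glue_place[OF assms] by (auto simp: partner_config_def)
  also have "\<dots> \<longleftrightarrow> slot_at T q = Single"
  proof (cases "slot_at T q")
    case (Paired r a)
    then have "before q r \<or> before r q"
      using well_formedD(2)[OF wf[OF assms(1)] assms(2)] by blast
    then show ?thesis using Paired by (auto simp: partner_def before_def)
  qed (simp_all add: partner_def)
  finally show ?thesis .
qed

lemma ones_row:
  assumes "(T, s) \<in> Bs" "i < length T"
  shows "{j. (Suc (s + i), j) \<in> ones G} = Suc ` set (single_columns T i)"
proof -
  have "(Suc (s + i), j) \<in> ones G \<longleftrightarrow> j \<in> Suc ` set (single_columns T i)" for j
  proof (cases "1 \<le> j \<and> j \<le> 4")
    case True
    then have "in_table T (i, j - 1)" "(Suc (s + i), j) = place s (i, j - 1)"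
      using assms(2) by (auto simp: in_table_def place_def)
    then have "(Suc (s + i), j) \<in> ones G \<longleftrightarrow> slot_at T (i, j - 1) = Single"
      using ones_place[OF assms(1)] by simp
    then show ?thesis
      using True by (cases j) (auto simp: set_single_columns)
  next
    case False
    then have "(Suc (s + i), j) \<notin> ones G"
      using glue_in_grid[of "(Suc (s + i), j)"] by (auto simp: partner_config_def grid_def)
    then show ?thesis using False by (auto simp: set_single_columns)
  qed
  then show ?thesis by blast
qed

lemma card_ones_row:
  assumes "(T, s) \<in> Bs" "i < length T"
  shows "card {j. (Suc (s + i), j) \<in> ones G} = length (single_columns T i)"
  unfolding ones_row[OF assms]
  by (simp add: card_image distinct_card[OF distinct_single_columns])

lemma card_ones: "card (ones G) = (\<Sum>i<m. card {j. (Suc i, j) \<in> ones G})"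
proof -
  have fin: "finite (ones G)"
    using configuration_finite(1)[OF configuration_glue] .
  have sub: "ones G \<subseteq> grid m 4"
    using configuration_glue by (simp add: configuration_def)
  have "ones G = (\<lambda>(i, j). (Suc i, j)) ` (SIGMA i:{..<m}. {j. (Suc i, j) \<in> ones G})"
  proof
    show "ones G \<subseteq> (\<lambda>(i, j). (Suc i, j)) ` (SIGMA i:{..<m}. {j. (Suc i, j) \<in> ones G})"
    proof
      fix p assume p: "p \<in> ones G"
      then have "1 \<le> fst p" "fst p \<le> m" using sub by (auto simp: grid_def)
      then show "p \<in> (\<lambda>(i, j). (Suc i, j)) ` (SIGMA i:{..<m}. {j. (Suc i, j) \<in> ones G})"
        using p by (intro image_eqI[of _ _ "(fst p - 1, snd p)"]) auto
    qed
  qed auto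
  then have "card (ones G) = card ((\<lambda>(i, j). (Suc i, j)) ` (SIGMA i:{..<m}. {j. (Suc i, j) \<in> ones G}))"
    by simp
  also have "\<dots> = card (SIGMA i:{..<m}. {j. (Suc i, j) \<in> ones G})"
    by (intro card_image) (auto simp: inj_on_def)
  also have "\<dots> = (\<Sum>i<m. card {j. (Suc i, j) \<in> ones G})"
  proof (rule card_SigmaI)
    have "{j. (Suc i, j) \<in> ones G} \<subseteq> snd ` ones G" for i by force
    then show "\<forall>i\<in>{..<m}. finite {j. (Suc i, j) \<in> ones G}"
      using fin finite_subset by blast
  qed simp
  finally show ?thesis .
qed

lemma hole_place:
  assumes "p \<in> grid m 4 - occupied G"
  shows "\<exists>T s q. (T, s) \<in> Bs \<and> q \<in> set (empty_cells T) \<and> p = place s q"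
proof -
  obtain T s q where q: "(T, s) \<in> Bs" "in_table T q" "p = place s q"
    using grid_cell assms by blast
  then have "partner T q = None"
    using assms occupied_partner_config[OF involutive_glue] glue_place[OF q(1,2)] by simp
  then have "slot_at T q = Empty"
    by (simp add: partner_def split: slot.splits)
  then show ?thesis
    using q by (intro exI[of _ T] exI[of _ s] exI[of _ q]) (simp add: set_empty_cells)
qed

end

text \<open>One-edges in a starting block: on average one for each row and six more, with no two rows sharing two
  columns. All rows of the repeated block carry exactly one one-edge, so repetitions cannot create a rectangle
  and keep the number of one-edges at the number of rows plus six.\<close>
definition base_shape :: "table \<Rightarrow> bool" where
  "base_shape T \<longleftrightarrow>
     sum_list (map (\<lambda>i. length (single_columns T i)) [0..<length T]) = length T + 6 \<and>
     sorted_wrt (\<lambda>i k. length (filter (\<lambda>j. j \<in> set (single_columns T k)) (single_columns T i)) \<le> 1) [0..<length T] \<and>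
     length (empty_cells T) \<le> 1"

definition tail_shape :: "table \<Rightarrow> bool" where
  "tail_shape T \<longleftrightarrow> list_all (\<lambda>i. length (single_columns T i) = 1) [0..<length T] \<and> empty_cells T = []"

definition blocks :: "table \<Rightarrow> table \<Rightarrow> nat \<Rightarrow> (table \<times> nat) set" where
  "blocks B D t = insert (B, 0) ((\<lambda>k. (D, length B + length D * k)) ` {..<t})"

lemma block_system_blocks:
  assumes "well_formed B" "well_formed D" "D \<noteq> []" "B \<noteq> []"
  shows "block_system (blocks B D t) (length B + length D * t)"
proof
  show "well_formed T" if "(T, s) \<in> blocks B D t" for T s
    using that assms by (auto simp: blocks_def)
  have step: "length D * k + length D \<le> length D * k'" if "k < k'" for k k'
    using mult_le_mono2[of "Suc k" k' "length D"] that by simp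
  show "apart False S s T r" if "(S, s) \<in> blocks B D t" "(T, r) \<in> blocks B D t" "(S, s) \<noteq> (T, r)" for S s T r
    using that step assms(4) unfolding blocks_def apart_def
    by (auto simp: neq_iff)
  show "s + length T \<le> length B + length D * t" if "(T, s) \<in> blocks B D t" for T s
    using that step by (auto simp: blocks_def add.assoc)
  show "\<exists>T s. (T, s) \<in> blocks B D t \<and> s < i \<and> i \<le> s + length T"
    if "1 \<le> i" "i \<le> length B + length D * t" for i
  proof (cases "i \<le> length B")
    case True
    then show ?thesis using that(1) by (intro exI[of _ B] exI[of _ 0]) (auto simp: blocks_def)
  next
    case False
    define k where "k = (i - length B - 1) div length D"
    have D: "0 < length D" using assms(3) by simp
    have "k < t"
      unfolding k_def using that(2) False D by (simp add: div_less_iff_less_mult mult.commute)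
    moreover have "length D * k \<le> i - length B - 1" "i - length B - 1 < length D * k + length D"
      unfolding k_def using D by (simp_all add: dividend_less_times_div mult.commute add.commute)
    ultimately show ?thesis
      using False by (intro exI[of _ D] exI[of _ "length B + length D * k"]) (auto simp: blocks_def)
  qed
qed

text \<open>For RW3+ the blocks need to be compared in pairs only: the starting block with the repeated
  one, and the repeated one with a copy of itself. Two rows that share two columns of one-edges both carry at least two
  one-edges, so they lie in the starting block.\<close>
lemma blocks_extremal:
  fixes B D :: table and t :: nat
  defines "m \<equiv> length B + length D * t"
  defines "G \<equiv> partner_config (glue (blocks B D t))"
  assumes wfs: "well_formed B" "well_formed D" and ne: "B \<noteq> []" "D \<noteq> []"
    and shape: "base_shape B" "tail_shape D"
    and B: "certifiable d B" "perp_within d B"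
    and D: "certifiable d D" "perp_within d D"
    and BD: "perp_between d B D" and DD: "perp_between d D D"
  shows "configuration m 4 G" "simple G" "RW3_plus G" "C4_free (ones G)" "card (ones G) = m + 6"
    "num_holes m 4 G \<le> 1"
proof -
  let ?Bs = "blocks B D t"
  interpret block_system ?Bs m
    unfolding m_def by (rule block_system_blocks[OF wfs ne(2,1)])
  show conf: "configuration m 4 G"
    unfolding G_def by (rule configuration_glue)
  show "simple G"
    unfolding G_def by (rule simple_partner_config[OF involutive_glue])
  have cases: "(T = B \<and> s = 0) \<or> (\<exists>k<t. T = D \<and> s = length B + length D * k)" if "(T, s) \<in> ?Bs" for T s
    using that by (auto simp: blocks_def)
  show "RW3_plus G"
    unfolding G_def
  proof (rule RW3_plus_blocks[OF involutive_glue configuration_glue])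
    show "placed (glue ?Bs) T s \<and> well_formed T \<and> certifiable d T \<and> perp_within d T" if "(T, s) \<in> ?Bs" for T s
      using placed_glue[OF that] cases[OF that] wfs B D by blast
    show "\<exists>T s q. (T, s) \<in> ?Bs \<and> in_table T q \<and> p = place s q" if "glue ?Bs p \<noteq> None" for p
      using glue_cover[OF that] .
    show "apart False S s T r \<and> (perp_between d S T \<or> perp_between d T S)"
      if "(S, s) \<in> ?Bs" "(T, r) \<in> ?Bs" "(S, s) \<noteq> (T, r)" for S s T r
      using sep[OF that] cases[OF that(1)] cases[OF that(2)] that(3) BD DD by auto
  qed
  have tail_row: "length (single_columns D i) = 1" if "i < length D" for i
    using shape(2) that by (simp add: tail_shape_def list_all_iff)
  have in_B: "(B, 0) \<in> ?Bs" by (simp add: blocks_def)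
  have base_row: "card {j. (Suc i, j) \<in> ones G} = length (single_columns B i)" if "i < length B" for i
    using card_ones_row[OF in_B that] by (simp add: G_def)
  have other_row: "card {j. (Suc i, j) \<in> ones G} = 1" if i: "length B \<le> i" "i < m" for i
  proof -
    obtain T s where T: "(T, s) \<in> ?Bs" "s < Suc i" "Suc i \<le> s + length T"
      using rows[of "Suc i"] i(2) by auto
    then have "T = D" using cases[OF T(1)] i(1) by auto
    then show ?thesis
      using card_ones_row[OF T(1), of "i - s"] tail_row[of "i - s"] T(2,3) by (simp add: G_def)
  qed
  show "card (ones G) = m + 6"
  proof -
    have "card (ones G) = (\<Sum>i<m. card {j. (Suc i, j) \<in> ones G})"
      unfolding G_def by (rule card_ones)
    also have "\<dots> = (\<Sum>i<length B. card {j. (Suc i, j) \<in> ones G}) + (\<Sum>i\<in>{length B..<m}. card {j. (Suc i, j) \<in> ones G})"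
      by (metis (no_types) sum.atLeastLessThan_concat le_add1 lessThan_atLeast0 m_def zero_le)
    also have "(\<Sum>i<length B. card {j. (Suc i, j) \<in> ones G}) = sum_list (map (\<lambda>i. length (single_columns B i)) [0..<length B])"
      using base_row by (simp add: interv_sum_list_conv_sum_set_nat lessThan_atLeast0)
    also have "\<dots> = length B + 6" using shape(1) by (simp add: base_shape_def)
    also have "(\<Sum>i\<in>{length B..<m}. card {j. (Suc i, j) \<in> ones G}) = m - length B"
      using other_row by simp
    finally show ?thesis by (simp add: m_def)
  qed
  show "C4_free (ones G)"
    unfolding C4_free_def
  proof
    assume "\<exists>i k j l. i \<noteq> k \<and> j \<noteq> l \<and> (i, j) \<in> ones G \<and> (k, l) \<in> ones G \<and> (i, l) \<in> ones G \<and> (k, j) \<in> ones G"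
    then obtain i k j l where r: "i \<noteq> k" "j \<noteq> l" "(i, j) \<in> ones G" "(k, l) \<in> ones G" "(i, l) \<in> ones G" "(k, j) \<in> ones G"
      by blast
    have base: "\<exists>i'<length B. i = Suc i' \<and> {j - 1, l - 1} \<subseteq> set (single_columns B i') \<and> 1 \<le> j \<and> 1 \<le> l"
      if il: "(i, j) \<in> ones G" "(i, l) \<in> ones G" for i
    proof -
      have grid: "(i, j) \<in> grid m 4"
        using il(1) conf by (auto simp: configuration_def)
      then obtain i' where i': "i = Suc i'" "i' < m" by (cases i) (auto simp: grid_def)
      have fin: "finite {j. (i, j) \<in> ones G}"
        by (rule finite_subset[OF _ finite_imageI[OF configuration_finite(1)[OF conf], of snd]]) force
      have "card {j, l} \<le> card {j. (i, j) \<in> ones G}"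
        using il by (intro card_mono[OF fin]) simp
      then have "i' < length B"
        using other_row[of i'] i' r(2) by (cases "i' < length B") simp_all
      moreover from this have "{j, l} \<subseteq> Suc ` set (single_columns B i')"
        using ones_row[OF in_B, of i'] il i'(1) by (auto simp: G_def)
      ultimately show ?thesis using i'(1) by auto
    qed
    obtain i' where i': "i' < length B" "i = Suc i'" "{j - 1, l - 1} \<subseteq> set (single_columns B i')" "1 \<le> j" "1 \<le> l"
      using base[OF r(3,5)] by blast
    obtain k' where k': "k' < length B" "k = Suc k'" "{j - 1, l - 1} \<subseteq> set (single_columns B k')"
      using base[OF r(6,4)] by blast
    have two: False
      if "a < c" "c < length B" "{j - 1, l - 1} \<subseteq> set (single_columns B a)" "{j - 1, l - 1} \<subseteq> set (single_columns B c)" for a c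
    proof -
      let ?f = "filter (\<lambda>j. j \<in> set (single_columns B c)) (single_columns B a)"
      have "sorted_wrt (\<lambda>i k. length (filter (\<lambda>j. j \<in> set (single_columns B k)) (single_columns B i)) \<le> 1) [0..<length B]"
        using shape(1) by (simp add: base_shape_def)
      from sorted_wrt_nth_less[OF this, of a c] have "length ?f \<le> 1"
        using that(1,2) by simp
      then have "card (set ?f) \<le> 1"
        using card_length[of ?f] by linarith
      moreover have "card {j - 1, l - 1} \<le> card (set ?f)"
        using that(3,4) by (intro card_mono) auto
      moreover have "card {j - 1, l - 1} = 2"
        using r(2) i'(4,5) by (simp add: card_2_iff eq_diff_iff)
      ultimately show False by simp
    qed
    have "i' \<noteq> k'" using r(1) i'(2) k'(2) by simp
    then show False
      using two[of i' k'] two[of k' i'] i'(1,3) k'(1,3) by (auto simp: neq_iff)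
  qed
  have "grid m 4 - occupied G \<subseteq> place 0 ` set (empty_cells B)"
  proof
    fix p assume "p \<in> grid m 4 - occupied G"
    then obtain T s q where q: "(T, s) \<in> ?Bs" "q \<in> set (empty_cells T)" "p = place s q"
      using hole_place unfolding G_def by blast
    then have "T = B \<and> s = 0"
      using cases[OF q(1)] shape(2) by (auto simp: tail_shape_def)
    then show "p \<in> place 0 ` set (empty_cells B)" using q(2,3) by blast
  qed
  then have "num_holes m 4 G \<le> card (place 0 ` set (empty_cells B))"
    unfolding num_holes_def by (intro card_mono) auto
  also have "\<dots> \<le> card (set (empty_cells B))" by (rule card_image_le) simp
  also have "\<dots> \<le> length (empty_cells B)" by (rule card_length)
  also have "\<dots> \<le> 1" using shape(1) by (simp add: base_shape_def)
  finally show "num_holes m 4 G \<le> 1" .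
qed

section \<open>The blocks\<close>

text \<open>Blocks are written as matrices of marks. Equal numbers mark the two cells of a two-edge, and
  the number is its rank.\<close>

datatype mark = Hole | One | Two nat
definition mark_slot :: "mark list list \<Rightarrow> cell \<Rightarrow> slot" where
  "mark_slot M p = (case M ! fst p ! snd p of
       Hole \<Rightarrow> Empty
     | One \<Rightarrow> Single
     | Two a \<Rightarrow> (case filter (\<lambda>q. q \<noteq> p \<and> M ! fst q ! snd q = Two a) (List.product [0..<length M] [0..<4]) of
           [] \<Rightarrow> Empty
         | q # _ \<Rightarrow> Paired q a))"

definition table_of :: "mark list list \<Rightarrow> table" where
  "table_of M = map (\<lambda>i. map (\<lambda>j. mark_slot M (i, j)) [0..<4]) [0..<length M]"

text \<open>The repeated block. The two-edges 1 and 2, 3 and 4, 5 and 6 are the two diagonals of a rectangle and certify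
  each other. The companion diagonal of 7 has one cell in 1 and one in 3, and these two edges meet in the
  last column; in the same way 2 and 5 certify 8, and 4 and 6 certify 9.\<close>
definition tail_marks :: "mark list list" where
  "tail_marks = [
     [One, Two 7, Two 1, Two 2],
     [Two 8, One, Two 2, Two 1],
     [One, Two 3, Two 7, Two 4],
     [Two 5, One, Two 8, Two 6],
     [Two 9, Two 4, One, Two 3],
     [Two 6, Two 9, One, Two 5]]"

text \<open>The starting blocks are the outcome of a computer search for tables whose closure leaves no pair of
  edges undecided. Their first six rows carry two one-edges each, one row for each pair of columns. As
  \<open>2 N + H = 5 m + 6\<close>, blocks with an odd number of rows have one hole.\<close>
definition base15_marks :: "mark list list" where
  "base15_marks = [
     [One, One, Two 15, Two 13],
     [One, Two 17, One, Two 18],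
     [One, Two 16, Two 17, One],
     [Two 6, One, One, Hole],
     [Two 11, One, Two 9, One],
     [Two 1, Two 19, One, One],
     [Two 19, Two 18, One, Two 15],
     [Two 10, One, Two 2, Two 3],
     [Two 1, One, Two 13, Two 12],
     [Two 4, One, Two 4, Two 7],
     [Two 12, One, Two 3, Two 2],
     [Two 8, One, Two 7, Two 6],
     [Two 5, Two 5, Two 14, One],
     [Two 9, One, Two 8, Two 10],
     [Two 16, Two 14, Two 11, One]]"

definition base16_marks :: "mark list list" where
  "base16_marks = [
     [Two 1, One, Two 1, One],
     [One, One, Two 16, Two 18],
     [Two 14, One, One, Two 17],
     [One, Two 21, Two 18, One],
     [Two 19, Two 20, One, One],
     [One, Two 12, One, Two 11],
     [One, Two 2, Two 3, Two 16],
     [One, Two 3, Two 2, Two 15],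
     [Two 4, Two 10, One, Two 4],
     [Two 11, Two 5, One, Two 6],
     [Two 10, Two 6, One, Two 5],
     [Two 7, One, Two 8, Two 9],
     [Two 17, One, Two 21, Two 19],
     [Two 20, Two 15, Two 8, One],
     [Two 13, Two 14, One, Two 12],
     [Two 9, Two 13, One, Two 7]]"

definition base17_marks :: "mark list list" where
  "base17_marks = [
     [One, One, Two 20, Two 19],
     [One, Two 11, One, Two 21],
     [One, Two 15, Two 14, One],
     [Two 1, One, One, Two 22],
     [Two 16, One, Two 2, One],
     [Two 11, Two 8, One, One],
     [One, Two 3, Two 2, Two 3],
     [Two 17, Two 9, Two 12, One],
     [Two 10, Two 4, Two 5, One],
     [Two 22, One, Two 21, Two 20],
     [Two 8, Hole, Two 9, One],
     [Two 13, Two 5, Two 4, One],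
     [Two 15, Two 12, Two 16, One],
     [Two 6, Two 6, Two 10, One],
     [Two 19, One, Two 17, Two 18],
     [Two 7, One, Two 18, Two 7],
     [Two 1, Two 14, Two 13, One]]"

definition base18_marks :: "mark list list" where
  "base18_marks = [
     [One, One, Two 21, Two 23],
     [One, Two 24, One, Two 1],
     [One, Two 13, Two 15, One],
     [Two 16, One, One, Two 18],
     [Two 21, One, Two 19, One],
     [Two 18, Two 14, One, One],
     [Two 17, One, Two 2, Two 22],
     [Two 3, Two 16, Two 4, One],
     [Two 5, Two 6, One, Two 9],
     [One, Two 11, Two 24, Two 14],
     [Two 13, Two 12, Two 2, One],
     [Two 7, One, Two 20, Two 7],
     [Two 19, One, Two 17, Two 20],
     [Two 4, Two 15, Two 3, One],
     [Two 12, Two 10, One, Two 11],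
     [Two 22, One, Two 23, Two 1],
     [Two 6, Two 5, One, Two 10],
     [Two 8, Two 9, One, Two 8]]"

definition base19_marks :: "mark list list" where
  "base19_marks = [
     [One, One, Two 1, Two 25],
     [One, Two 23, One, Two 24],
     [One, Two 17, Two 13, One],
     [Two 10, One, One, Two 14],
     [Two 13, One, Two 11, One],
     [Two 19, Two 20, One, One],
     [Two 15, Two 18, One, Two 21],
     [Two 2, Two 2, Two 1, One],
     [Two 14, Two 16, One, Two 15],
     [Two 5, One, Two 9, Hole],
     [Two 3, One, Two 4, Two 5],
     [One, Two 21, Two 25, Two 22],
     [Two 4, One, Two 3, Two 6],
     [Two 18, Two 19, One, Two 20],
     [Two 11, One, Two 6, Two 7],
     [Two 12, One, Two 7, Two 8],
     [Two 9, One, Two 8, Two 10],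
     [One, Two 22, Two 24, Two 23],
     [Two 16, One, Two 17, Two 12]]"

definition base20_marks :: "mark list list" where
  "base20_marks = [
     [One, One, Two 25, Two 24],
     [One, Two 24, One, Two 23],
     [One, Two 20, Two 19, One],
     [Two 8, One, One, Two 7],
     [Two 27, One, Two 1, One],
     [Two 16, Two 27, One, One],
     [Two 7, One, Two 2, Two 3],
     [Two 26, Two 25, Two 4, One],
     [One, Two 23, Two 4, Two 22],
     [Two 18, One, Two 14, Two 12],
     [Two 10, One, Two 11, Two 9],
     [One, Two 22, Two 1, Two 21],
     [Two 17, One, Two 20, Two 14],
     [One, Two 21, Two 18, Two 19],
     [Two 13, One, Two 15, Two 17],
     [Two 11, One, Two 12, Two 10],
     [Two 9, One, Two 13, Two 8],
     [Two 5, One, Two 6, Two 5],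
     [Two 15, One, Two 16, Two 26],
     [Two 6, One, Two 3, Two 2]]"

text \<open>Chains of at most 14 transfers are enough for all the pairs below.\<close>
definition starting_table :: "nat \<Rightarrow> table \<Rightarrow> bool" where
  "starting_table b B \<longleftrightarrow> length B = b \<and> well_formed B \<and> base_shape B \<and> certifiable 14 B \<and> perp_within 14 B \<and>
     perp_between 14 B (table_of tail_marks)"

lemma tail_checks:
  "length (table_of tail_marks) = 6" "well_formed (table_of tail_marks)" "tail_shape (table_of tail_marks)"
  "certifiable 14 (table_of tail_marks)" "perp_within 14 (table_of tail_marks)"
  "perp_between 14 (table_of tail_marks) (table_of tail_marks)"
  by code_simp+

lemma starting_table_15: "starting_table 15 (table_of base15_marks)"
  by code_simp

lemma starting_table_16: "starting_table 16 (table_of base16_marks)"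
  by code_simp

lemma starting_table_17: "starting_table 17 (table_of base17_marks)"
  by code_simp

lemma starting_table_18: "starting_table 18 (table_of base18_marks)"
  by code_simp

lemma starting_table_19: "starting_table 19 (table_of base19_marks)"
  by code_simp

lemma starting_table_20: "starting_table 20 (table_of base20_marks)"
  by code_simp

lemma starting_table_exists:
  assumes "b \<in> {15..20}"
  shows "\<exists>B. starting_table b B"
proof -
  have "b = 15 \<or> b = 16 \<or> b = 17 \<or> b = 18 \<or> b = 19 \<or> b = 20"
    using assms by auto
  then show ?thesis
    using starting_table_15 starting_table_16 starting_table_17 starting_table_18
      starting_table_19 starting_table_20 by blast
qed

text \<open>The residue of \<open>m - 15\<close> modulo 6 selects the starting block.\<close>
lemma extremal_configuration_exists:
  assumes "m \<ge> 15"
  shows "\<exists>G. configuration m 4 G \<and> simple G \<and> RW3_plus G \<and> C4_free (ones G) \<and> card (ones G) = m + 6 \<and>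
    num_holes m 4 G \<le> 1"
proof -
  let ?D = "table_of tail_marks"
  define b where "b = 15 + (m - 15) mod 6"
  define t where "t = (m - 15) div 6"
  have "b \<in> {15..20}"
    using mod_less_divisor[of 6 "m - 15"] by (simp add: b_def)
  then obtain B where B: "starting_table b B"
    using starting_table_exists by blast
  have m: "m = length B + length ?D * t"
    using assms B mult_div_mod_eq[of 6 "m - 15"]
    by (simp add: starting_table_def tail_checks(1) b_def t_def)
  have "B \<noteq> []" "?D \<noteq> []"
    using B tail_checks(1) by (auto simp: starting_table_def b_def)
  with B tail_checks show ?thesis
    unfolding m starting_table_def
    by (intro exI[of _ "partner_config (glue (blocks B ?D t))"] conjI) (rule blocks_extremal; blast)+
qed

theorem theorem1p1:
  fixes m :: nat
  assumes "m \<ge> 15"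
  shows "z_RL m 4 = z_2 m 4 \<and>
         int (z_2 m 4) = \<lfloor>(5 * real m + 6) / 2\<rfloor> \<and>
         (\<forall>G. RL_extremal m 4 G \<longrightarrow>
           (even m \<longrightarrow> num_holes m 4 G = 0) \<and> (odd m \<longrightarrow> num_holes m 4 G = 1))"
proof -
  obtain G where G: "configuration m 4 G" "simple G" "RW3_plus G" "C4_free (ones G)" "card (ones G) = m + 6"
    "num_holes m 4 G \<le> 1"
    using extremal_configuration_exists[OF assms] by blast
  have choose: "4 choose 2 = (6 :: nat)" by (simp add: numeral_eq_Suc)
  have z: "zarankiewicz m 4 = m + 6"
    using zarankiewicz_eqI[of "ones G" m 4] G(1,4,5) by (simp add: configuration_def choose)
  \<comment> \<open>the identity behind the upper bound and behind the number of holes\<close>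
  have count: "2 * num_edges H + num_holes m 4 H = 5 * m + 6" if "admissible m 4 H" for H
    using card_grid_eq[of m 4 H] that z by (simp add: admissible_def num_edges_def)
  have adm: "admissible m 4 G"
    using G z by (simp add: admissible_def)
  have edges: "num_edges G = (5 * m + 6) div 2"
    using count[OF adm] G(6) by linarith
  have bound: "num_edges H \<le> (5 * m + 6) div 2" if "admissible m 4 H" for H
    using count[OF that] by linarith
  have maximum: "Max {num_edges H | H. P H} = (5 * m + 6) div 2"
    if P: "P G" "\<And>H. P H \<Longrightarrow> admissible m 4 H" for P
  proof (rule Max_eqI)
    show le: "x \<le> (5 * m + 6) div 2" if "x \<in> {num_edges H | H. P H}" for x
    proof -
      obtain H where "P H" "x = num_edges H" using \<open>x \<in> {num_edges H | H. P H}\<close> by blast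
      then show ?thesis using bound[OF P(2)] by simp
    qed
    show "finite {num_edges H | H. P H}"
      by (rule finite_subset[of _ "{..(5 * m + 6) div 2}"]) (use le in blast, simp)
    show "(5 * m + 6) div 2 \<in> {num_edges H | H. P H}"
      unfolding edges[symmetric] using P(1) by blast
  qed
  have RL: "z_RL m 4 = (5 * m + 6) div 2"
    unfolding z_RL_def using adm G(3) by (intro maximum) (simp_all add: RL_feasible_def)
  have two: "z_2 m 4 = (5 * m + 6) div 2"
    unfolding z_2_def using adm RW3_plus_SOS_rank[OF G(1-3)]
    by (intro maximum) (simp_all add: second_order_feasible_def)
  have "\<lfloor>(5 * real m + 6) / 2\<rfloor> = \<lfloor>real (5 * m + 6) / real 2\<rfloor>" by simp
  also have "\<dots> = int ((5 * m + 6) div 2)" by (rule floor_divide_of_nat_eq)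
  finally have "int (z_2 m 4) = \<lfloor>(5 * real m + 6) / 2\<rfloor>" using two by simp
  moreover have "(even m \<longrightarrow> num_holes m 4 H = 0) \<and> (odd m \<longrightarrow> num_holes m 4 H = 1)"
    if "RL_extremal m 4 H" for H
  proof -
    have "admissible m 4 H" "num_edges H = (5 * m + 6) div 2"
      using that RL by (simp_all add: RL_extremal_def RL_feasible_def)
    then have "num_holes m 4 H = (5 * m + 6) mod 2"
      using count[of H] by presburger
    then show ?thesis by presburger
  qed
  ultimately show ?thesis using RL two by simp
qed

end
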